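(* Let $(A,\Delta)$ be a nearly Frobenius algebra over a field $k$ and let $J\subset A$ be a nearly Frobenius ideal. Then $A/J$ admits a unique nearly Frobenius structure such that the canonical projection $p:A\to A/J$ is a morphism of nearly Frobenius algebras.
   Context: Algebras are associative and unital over the field $k$, with multiplication $m:A\otimes A\to A$; $\otimes=\otimes_k$. A nearly Frobenius algebra $(A,\Delta)$ is a $k$-algebra $A$ together with a $k$-linear map $\Delta:A\to A\otimes A$ (a nearly Frobenius coproduct, or nearly Frobenius structure) such that (1) $(\Delta\otimes 1)\circ\Delta=(1\otimes\Delta)\circ\Delta$; and (2) $\Delta$ is a morphism of $A$-bimodules: $\Delta\circ m=(1\otimes m)\circ(\Delta\otimes 1)$ and $\Delta\circ m=(m\otimes 1)\circ(1\otimes\Delta)$. A morphism of nearly Frobenius algebras $f:(A,\Delta_A)\to(B,\Delta_B)$ is a morphism of algebras $f:A\to B$ with $(f\otimes f)\circ\Delta_A=\Delta_B\circ f$. A linear subspace $J\subset A$ is a nearly Frobenius ideal of $(A,\Delta)$ if $J$ is a (two-sided) ideal of $A$ and $\Delta(J)\subset J\otimes A+A\otimes J$. *)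

theory Defs
  imports "HOL-Algebra.Module" "HOL-Algebra.QuotRing"
begin

section \<open>Modules\<close>

definition module_hom :: "('k, 'r) ring_scheme \<Rightarrow> ('k, 'a, 'm) module_scheme
    \<Rightarrow> ('k, 'b, 'n) module_scheme \<Rightarrow> ('a \<Rightarrow> 'b) set"
  where "module_hom k M N = {f \<in> carrier M \<rightarrow> carrier N.
    (\<forall>x\<in>carrier M. \<forall>y\<in>carrier M. f (x \<oplus>\<^bsub>M\<^esub> y) = f x \<oplus>\<^bsub>N\<^esub> f y) \<and>
    (\<forall>c\<in>carrier k. \<forall>x\<in>carrier M. f (c \<odot>\<^bsub>M\<^esub> x) = c \<odot>\<^bsub>N\<^esub> f x)}"

definition submodule_span :: "('k, 'r) ring_scheme \<Rightarrow> ('k, 'a, 'm) module_scheme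
    \<Rightarrow> 'a set \<Rightarrow> 'a set"
  where "submodule_span k M S = \<Inter>{H. submodule H k M \<and> S \<subseteq> H}"

text \<open>
  The record type \<^typ>\<open>('k, 'a) module\<close> extends rings, so one quotient serves both for a module
  by a submodule and for an algebra by an ideal. For a plain module the fields \<^const>\<open>mult\<close> and
  \<^const>\<open>one\<close> are meaningless, both before and after passing to the quotient.
\<close>

definition quot_module :: "('k, 'a, 'm) module_scheme \<Rightarrow> 'a set \<Rightarrow> ('k, 'a set) module"
    (infixl \<open>QuotM\<close> 65)
  where "M QuotM N =
    ring.extend (M Quot N) (module.fields (\<lambda>c C. \<Union>x\<in>C. N +>\<^bsub>M\<^esub> (c \<odot>\<^bsub>M\<^esub> x)))"

definition free_module :: "('k, 'r) ring_scheme \<Rightarrow> 's set \<Rightarrow> ('k, 's \<Rightarrow> 'k) module"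
  where "free_module k S =
    \<lparr>carrier = {\<phi>. range \<phi> \<subseteq> carrier k \<and> finite {s. \<phi> s \<noteq> \<zero>\<^bsub>k\<^esub>} \<and> {s. \<phi> s \<noteq> \<zero>\<^bsub>k\<^esub>} \<subseteq> S},
     mult = undefined, one = undefined,
     zero = (\<lambda>s. \<zero>\<^bsub>k\<^esub>), add = (\<lambda>\<phi> \<psi> s. \<phi> s \<oplus>\<^bsub>k\<^esub> \<psi> s),
     smult = (\<lambda>c \<phi> s. c \<otimes>\<^bsub>k\<^esub> \<phi> s)\<rparr>"

definition free_gen :: "('k, 'r) ring_scheme \<Rightarrow> 's \<Rightarrow> 's \<Rightarrow> 'k"
  where "free_gen k s = (\<lambda>t. if t = s then \<one>\<^bsub>k\<^esub> else \<zero>\<^bsub>k\<^esub>)"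


section \<open>Tensor products\<close>

definition tensor_relations :: "('k, 'r) ring_scheme \<Rightarrow> ('k, 'a, 'm) module_scheme
    \<Rightarrow> ('k, 'b, 'n) module_scheme \<Rightarrow> ('a \<times> 'b \<Rightarrow> 'k) set"
  where "tensor_relations k M N =
    (let F = free_module k (carrier M \<times> carrier N); e = (\<lambda>x y. free_gen k (x, y)) in
      {e (x \<oplus>\<^bsub>M\<^esub> x') y \<ominus>\<^bsub>F\<^esub> (e x y \<oplus>\<^bsub>F\<^esub> e x' y) | x x' y.
         x \<in> carrier M \<and> x' \<in> carrier M \<and> y \<in> carrier N} \<union>
      {e x (y \<oplus>\<^bsub>N\<^esub> y') \<ominus>\<^bsub>F\<^esub> (e x y \<oplus>\<^bsub>F\<^esub> e x y') | x y y'.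
         x \<in> carrier M \<and> y \<in> carrier N \<and> y' \<in> carrier N} \<union>
      {e (c \<odot>\<^bsub>M\<^esub> x) y \<ominus>\<^bsub>F\<^esub> (c \<odot>\<^bsub>F\<^esub> e x y) | c x y.
         c \<in> carrier k \<and> x \<in> carrier M \<and> y \<in> carrier N} \<union>
      {e x (c \<odot>\<^bsub>N\<^esub> y) \<ominus>\<^bsub>F\<^esub> (c \<odot>\<^bsub>F\<^esub> e x y) | c x y.
         c \<in> carrier k \<and> x \<in> carrier M \<and> y \<in> carrier N})"

definition tensor_kernel :: "('k, 'r) ring_scheme \<Rightarrow> ('k, 'a, 'm) module_scheme
    \<Rightarrow> ('k, 'b, 'n) module_scheme \<Rightarrow> ('a \<times> 'b \<Rightarrow> 'k) set"
  where "tensor_kernel k M N =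
    submodule_span k (free_module k (carrier M \<times> carrier N)) (tensor_relations k M N)"

definition tensor :: "('k, 'r) ring_scheme \<Rightarrow> ('k, 'a, 'm) module_scheme
    \<Rightarrow> ('k, 'b, 'n) module_scheme \<Rightarrow> ('k, ('a \<times> 'b \<Rightarrow> 'k) set) module"
  where "tensor k M N = free_module k (carrier M \<times> carrier N) QuotM tensor_kernel k M N"

definition pure_tensor :: "('k, 'r) ring_scheme \<Rightarrow> ('k, 'a, 'm) module_scheme
    \<Rightarrow> ('k, 'b, 'n) module_scheme \<Rightarrow> 'a \<Rightarrow> 'b \<Rightarrow> ('a \<times> 'b \<Rightarrow> 'k) set"
  where "pure_tensor k M N x y =
    tensor_kernel k M N +>\<^bsub>free_module k (carrier M \<times> carrier N)\<^esub> free_gen k (x, y)"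

text \<open>
  The linear map out of a tensor product induced by a bilinear map \<open>\<beta>\<close> into \<open>P\<close>, i.e.
  \<open>x \<otimes> y \<mapsto> \<beta> x y\<close>. Bilinearity makes the value independent of the representative \<open>\<phi>\<close> of the
  class \<open>t\<close>; the definition is only used for such \<open>\<beta>\<close>.
\<close>

definition tensor_lift :: "('k, 'r) ring_scheme \<Rightarrow> ('k, 'c, 'p) module_scheme
    \<Rightarrow> ('a \<Rightarrow> 'b \<Rightarrow> 'c) \<Rightarrow> ('a \<times> 'b \<Rightarrow> 'k) set \<Rightarrow> 'c"
  where "tensor_lift k P \<beta> t = (let \<phi> = (SOME \<phi>. \<phi> \<in> t) in
    \<Oplus>\<^bsub>P\<^esub>s\<in>{s. \<phi> s \<noteq> \<zero>\<^bsub>k\<^esub>}. \<phi> s \<odot>\<^bsub>P\<^esub> \<beta> (fst s) (snd s))"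

text \<open>The map \<open>f \<otimes> g\<close> between tensor products, for linear maps \<open>f\<close> and \<open>g\<close> with targets \<open>M'\<close> and \<open>N'\<close>.\<close>

definition tensor_map :: "('k, 'r) ring_scheme \<Rightarrow> ('k, 'c, 'p) module_scheme
    \<Rightarrow> ('k, 'd, 'q) module_scheme \<Rightarrow> ('a \<Rightarrow> 'c) \<Rightarrow> ('b \<Rightarrow> 'd)
    \<Rightarrow> ('a \<times> 'b \<Rightarrow> 'k) set \<Rightarrow> ('c \<times> 'd \<Rightarrow> 'k) set"
  where "tensor_map k M' N' f g =
    tensor_lift k (tensor k M' N') (\<lambda>x y. pure_tensor k M' N' (f x) (g y))"

text \<open>
  The canonical identifications of \<open>(M \<otimes> N) \<otimes> P\<close> with \<open>M \<otimes> (N \<otimes> P)\<close>, which are usually left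
  implicit: \<open>(x \<otimes> y) \<otimes> z \<mapsto> x \<otimes> (y \<otimes> z)\<close> and its inverse.
\<close>

definition tensor_assoc :: "('k, 'r) ring_scheme \<Rightarrow> ('k, 'a, 'm) module_scheme
    \<Rightarrow> ('k, 'b, 'n) module_scheme \<Rightarrow> ('k, 'c, 'p) module_scheme
    \<Rightarrow> (('a \<times> 'b \<Rightarrow> 'k) set \<times> 'c \<Rightarrow> 'k) set \<Rightarrow> ('a \<times> ('b \<times> 'c \<Rightarrow> 'k) set \<Rightarrow> 'k) set"
  where "tensor_assoc k M N P =
    (let T = tensor k M (tensor k N P) in
      tensor_lift k T (\<lambda>u z. tensor_lift k T
        (\<lambda>x y. pure_tensor k M (tensor k N P) x (pure_tensor k N P y z)) u))"

definition tensor_assoc_inv :: "('k, 'r) ring_scheme \<Rightarrow> ('k, 'a, 'm) module_scheme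
    \<Rightarrow> ('k, 'b, 'n) module_scheme \<Rightarrow> ('k, 'c, 'p) module_scheme
    \<Rightarrow> ('a \<times> ('b \<times> 'c \<Rightarrow> 'k) set \<Rightarrow> 'k) set \<Rightarrow> (('a \<times> 'b \<Rightarrow> 'k) set \<times> 'c \<Rightarrow> 'k) set"
  where "tensor_assoc_inv k M N P =
    (let T = tensor k (tensor k M N) P in
      tensor_lift k T (\<lambda>x u. tensor_lift k T
        (\<lambda>y z. pure_tensor k (tensor k M N) P (pure_tensor k M N x y) z) u))"


section \<open>Algebras\<close>

text \<open>The library's locale \<^locale>\<open>algebra\<close> is restricted to commutative algebras.\<close>

locale assoc_algebra = field k + module k A + A: ring A
  for k (structure) and A (structure) +
  assumes smult_mult_left: "\<lbrakk>c \<in> carrier k; x \<in> carrier A; y \<in> carrier A\<rbrakk>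
      \<Longrightarrow> (c \<odot>\<^bsub>A\<^esub> x) \<otimes>\<^bsub>A\<^esub> y = c \<odot>\<^bsub>A\<^esub> (x \<otimes>\<^bsub>A\<^esub> y)"
    and smult_mult_right: "\<lbrakk>c \<in> carrier k; x \<in> carrier A; y \<in> carrier A\<rbrakk>
      \<Longrightarrow> x \<otimes>\<^bsub>A\<^esub> (c \<odot>\<^bsub>A\<^esub> y) = c \<odot>\<^bsub>A\<^esub> (x \<otimes>\<^bsub>A\<^esub> y)"

definition assoc_algebra_hom :: "('k, 'r) ring_scheme \<Rightarrow> ('k, 'a, 'm) module_scheme
    \<Rightarrow> ('k, 'b, 'n) module_scheme \<Rightarrow> ('a \<Rightarrow> 'b) set"
  where "assoc_algebra_hom k A B = ring_hom A B \<inter> module_hom k A B"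

definition mult_map :: "('k, 'r) ring_scheme \<Rightarrow> ('k, 'a, 'm) module_scheme
    \<Rightarrow> ('a \<times> 'a \<Rightarrow> 'k) set \<Rightarrow> 'a"
  where "mult_map k A = tensor_lift k A (\<lambda>x y. x \<otimes>\<^bsub>A\<^esub> y)"


section \<open>Nearly Frobenius algebras\<close>

text \<open>
  In \<open>bimodule_left\<close> and \<open>bimodule_right\<close>, both sides are maps \<open>A \<otimes> A \<rightarrow> A \<otimes> A\<close>. The names refer
  to which of the two factors is comultiplied.
\<close>

locale nearly_frobenius_algebra = assoc_algebra k A
  for k (structure) and A (structure) +
  fixes \<Delta> :: "'b \<Rightarrow> ('b \<times> 'b \<Rightarrow> 'a) set"
  assumes coproduct_linear: "\<Delta> \<in> module_hom k A (tensor k A A)"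
    and coassoc: "a \<in> carrier A \<Longrightarrow>
      tensor_assoc k A A A (tensor_map k (tensor k A A) A \<Delta> (\<lambda>x. x) (\<Delta> a)) =
      tensor_map k A (tensor k A A) (\<lambda>x. x) \<Delta> (\<Delta> a)"
    and bimodule_left: "t \<in> carrier (tensor k A A) \<Longrightarrow>
      \<Delta> (mult_map k A t) =
      tensor_map k A A (\<lambda>x. x) (mult_map k A)
        (tensor_assoc k A A A (tensor_map k (tensor k A A) A \<Delta> (\<lambda>x. x) t))"
    and bimodule_right: "t \<in> carrier (tensor k A A) \<Longrightarrow>
      \<Delta> (mult_map k A t) =
      tensor_map k A A (mult_map k A) (\<lambda>x. x)
        (tensor_assoc_inv k A A A (tensor_map k A (tensor k A A) (\<lambda>x. x) \<Delta> t))"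

definition nearly_frobenius_hom :: "('k, 'r) ring_scheme
    \<Rightarrow> ('k, 'a, 'm) module_scheme \<Rightarrow> ('a \<Rightarrow> ('a \<times> 'a \<Rightarrow> 'k) set)
    \<Rightarrow> ('k, 'b, 'n) module_scheme \<Rightarrow> ('b \<Rightarrow> ('b \<times> 'b \<Rightarrow> 'k) set) \<Rightarrow> ('a \<Rightarrow> 'b) set"
  where "nearly_frobenius_hom k A \<Delta>\<^sub>A B \<Delta>\<^sub>B = {f \<in> assoc_algebra_hom k A B.
    \<forall>a\<in>carrier A. tensor_map k B B f f (\<Delta>\<^sub>A a) = \<Delta>\<^sub>B (f a)}"

text \<open>
  For submodules \<open>U\<close> of \<open>M\<close> and \<open>V\<close> of \<open>N\<close>, the image of \<open>U \<otimes> V\<close> in \<open>M \<otimes> N\<close> under the map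
  induced by the inclusions; over a field this map is injective.
\<close>

definition subtensor :: "('k, 'r) ring_scheme \<Rightarrow> ('k, 'a, 'm) module_scheme
    \<Rightarrow> ('k, 'b, 'n) module_scheme \<Rightarrow> 'a set \<Rightarrow> 'b set \<Rightarrow> ('a \<times> 'b \<Rightarrow> 'k) set set"
  where "subtensor k M N U V = tensor_map k M N (\<lambda>x. x) (\<lambda>y. y) `
    carrier (tensor k (M\<lparr>carrier := U\<rparr>) (N\<lparr>carrier := V\<rparr>))"

definition nearly_frobenius_ideal :: "('k, 'r) ring_scheme \<Rightarrow> ('k, 'a, 'm) module_scheme
    \<Rightarrow> ('a \<Rightarrow> ('a \<times> 'a \<Rightarrow> 'k) set) \<Rightarrow> 'a set \<Rightarrow> bool"
  where "nearly_frobenius_ideal k A \<Delta> J \<longleftrightarrow> submodule J k A \<and> ideal J A \<and>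
    \<Delta> ` J \<subseteq> subtensor k A A J (carrier A) <+>\<^bsub>tensor k A A\<^esub> subtensor k A A (carrier A) J"

end

theory Submission
  imports Defs
begin

text \<open>
  Write \<open>p\<close> for the projection \<open>A \<rightarrow> A/J\<close>. The condition that \<open>p\<close> be a morphism reads
  \<open>\<Delta>' \<circ> p = (p \<otimes> p) \<circ> \<Delta>\<close>. As \<open>p\<close> is onto, this prescribes \<open>\<Delta>'\<close> at every point of \<open>A/J\<close>, so there
  is at most one such \<open>\<Delta>'\<close> (among functions with a fixed value off the carrier). A linear \<open>\<Delta>'\<close> with
  this property exists exactly if \<open>(p \<otimes> p) \<circ> \<Delta>\<close> vanishes on \<open>J\<close>. It does: \<open>\<Delta>\<close> maps \<open>J\<close> into
  \<open>J \<otimes> A + A \<otimes> J\<close>, and \<open>p \<otimes> p\<close> kills both summands since one tensor factor of every generator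
  is killed by \<open>p\<close> (\<open>tensor_map_subtensor_zero\<close>, \<open>quot_module_factorization\<close>).

  The axioms for \<open>\<Delta>'\<close> then follow from those for \<open>\<Delta>\<close> because \<open>p\<close> and \<open>p \<otimes> p\<close> are onto: both sides
  of each axiom are natural in the algebra, so evaluated at an image under \<open>p\<close> or \<open>p \<otimes> p\<close> they are
  the images of the two sides of the axiom for \<open>\<Delta>\<close>. That argument applies to any surjective algebra
  homomorphism, and \<open>nearly_frobenius_algebra_image\<close> carries it out in this generality. It rests on the
  functoriality of \<open>\<otimes>\<close> (\<open>tensor_map_commuting_squares\<close>), the naturality of the associativity
  isomorphisms (\<open>tensor_assoc_natural\<close>, \<open>tensor_assoc_inv_natural\<close>) and that of the multiplication
  (\<open>mult_map_natural\<close>).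

  All identities between maps on tensor products are obtained from one principle: linear maps that
  agree on pure tensors are equal (\<open>tensor_hom_eqI\<close>). Together with the existence of the linear
  map induced by a bilinear one (\<open>tensor_lift_linear\<close>, \<open>tensor_lift_pure_tensor\<close>) this is the
  universal property of the tensor product, which is derived from that of free modules.
\<close>

section \<open>Linear maps and submodules\<close>

lemma module_homI:
  assumes "\<And>x. x \<in> carrier M \<Longrightarrow> f x \<in> carrier N"
    and "\<And>x y. \<lbrakk>x \<in> carrier M; y \<in> carrier M\<rbrakk> \<Longrightarrow> f (x \<oplus>\<^bsub>M\<^esub> y) = f x \<oplus>\<^bsub>N\<^esub> f y"
    and "\<And>c x. \<lbrakk>c \<in> carrier k; x \<in> carrier M\<rbrakk> \<Longrightarrow> f (c \<odot>\<^bsub>M\<^esub> x) = c \<odot>\<^bsub>N\<^esub> f x"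
  shows "f \<in> module_hom k M N"
  using assms by (simp add: module_hom_def)

lemma module_homD:
  assumes "f \<in> module_hom k M N"
  shows module_hom_closed: "x \<in> carrier M \<Longrightarrow> f x \<in> carrier N"
    and module_hom_add: "\<lbrakk>x \<in> carrier M; y \<in> carrier M\<rbrakk> \<Longrightarrow> f (x \<oplus>\<^bsub>M\<^esub> y) = f x \<oplus>\<^bsub>N\<^esub> f y"
    and module_hom_smult: "\<lbrakk>c \<in> carrier k; x \<in> carrier M\<rbrakk> \<Longrightarrow> f (c \<odot>\<^bsub>M\<^esub> x) = c \<odot>\<^bsub>N\<^esub> f x"
  using assms by (auto simp: module_hom_def)

lemma module_hom_zero:
  assumes "module k M" "module k N" "f \<in> module_hom k M N"
  shows "f \<zero>\<^bsub>M\<^esub> = \<zero>\<^bsub>N\<^esub>"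
proof -
  interpret M: module k M by fact
  interpret N: module k N by fact
  have "f \<zero>\<^bsub>M\<^esub> = f (\<zero>\<^bsub>k\<^esub> \<odot>\<^bsub>M\<^esub> \<zero>\<^bsub>M\<^esub>)" by simp
  also have "\<dots> = \<zero>\<^bsub>N\<^esub>"
    using module_hom_closed[OF assms(3)] by (simp only: module_hom_smult[OF assms(3)]
        M.R.zero_closed M.M.zero_closed) simp
  finally show ?thesis .
qed

lemma module_hom_minus:
  assumes "module k M" "module k N" "f \<in> module_hom k M N" "x \<in> carrier M"
  shows "f (\<ominus>\<^bsub>M\<^esub> x) = \<ominus>\<^bsub>N\<^esub> f x"
proof -
  interpret M: module k M by fact
  interpret N: module k N by fact
  have "f (\<ominus>\<^bsub>M\<^esub> x) \<oplus>\<^bsub>N\<^esub> f x = \<zero>\<^bsub>N\<^esub>"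
    using assms by (simp add: module_hom_add[symmetric, OF assms(3)] M.M.l_neg module_hom_zero)
  thus ?thesis
    using assms(4) module_hom_closed[OF assms(3)] by (simp add: N.M.minus_equality)
qed

lemma module_hom_id: "(\<lambda>x. x) \<in> module_hom k M M"
  by (simp add: module_hom_def)

lemma module_hom_compose:
  "\<lbrakk>f \<in> module_hom k M N; g \<in> module_hom k N P\<rbrakk> \<Longrightarrow> (\<lambda>x. g (f x)) \<in> module_hom k M P"
  by (auto simp: module_hom_def Pi_iff)

lemma module_hom_sum:
  assumes "module k N" and f: "f \<in> module_hom k M N" and g: "g \<in> module_hom k M N"
  shows "(\<lambda>x. f x \<oplus>\<^bsub>N\<^esub> g x) \<in> module_hom k M N"
proof -
  interpret N: module k N by fact
  show ?thesis
    by (rule module_homI)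
      (auto simp: module_homD[OF f] module_homD[OF g] N.smult_r_distr N.M.a_ac)
qed

lemma module_hom_scaled:
  assumes "module k N" and f: "f \<in> module_hom k M N" and c: "c \<in> carrier k"
  shows "(\<lambda>x. c \<odot>\<^bsub>N\<^esub> f x) \<in> module_hom k M N"
proof -
  interpret N: module k N by fact
  show ?thesis
    by (rule module_homI)
      (auto simp: module_homD[OF f] N.smult_r_distr N.smult_assoc1[symmetric] c N.R.m_comm)
qed

lemma submodule_zero_closed: "submodule H k M \<Longrightarrow> \<zero>\<^bsub>M\<^esub> \<in> H"
  using subgroup.one_closed[OF submodule.axioms(1)] by fastforce

text \<open>
  This is what turns "agrees on a spanning set" into "agrees everywhere": the set of agreement is a
  submodule, hence everything as soon as it contains a spanning set. The comparison with the zero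
  map shows that kernels are submodules.
\<close>

lemma submodule_equalizer:
  assumes "module k M" "module k N" and f: "f \<in> module_hom k M N" and g: "g \<in> module_hom k M N"
  shows "submodule {x \<in> carrier M. f x = g x} k M"
proof -
  interpret M: module k M by fact
  show ?thesis
    by (rule M.submoduleI)
      (auto simp: module_homD[OF f] module_homD[OF g] module_hom_zero[OF assms(1,2)] f g
        module_hom_minus[OF assms(1,2)])
qed

lemma submodule_vimage:
  assumes "module k M" "module k N" and f: "f \<in> module_hom k M N" and "submodule H k N"
  shows "submodule {x \<in> carrier M. f x \<in> H} k M"
proof -
  interpret M: module k M by fact
  interpret N: module k N by fact
  note H = N.submoduleE[OF assms(4)]
  have "\<zero>\<^bsub>N\<^esub> \<in> H"
    by (rule submodule_zero_closed) fact
  thus ?thesis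
    by (intro M.submoduleI)
      (auto simp: module_homD[OF f] module_hom_zero[OF assms(1,2)] f
        module_hom_minus[OF assms(1,2)] H)
qed

lemma submodule_image:
  assumes "module k M" "module k N" and f: "f \<in> module_hom k M N"
  shows "submodule (f ` carrier M) k N"
proof -
  interpret M: module k M by fact
  interpret N: module k N by fact
  show ?thesis
  proof (rule N.submoduleI)
    show "f ` carrier M \<subseteq> carrier N" by (auto simp: module_homD[OF f])
    show "\<zero>\<^bsub>N\<^esub> \<in> f ` carrier M"
      using module_hom_zero[OF assms] by (metis M.M.zero_closed image_eqI)
  next
    fix a assume "a \<in> f ` carrier M"
    thus "\<ominus>\<^bsub>N\<^esub> a \<in> f ` carrier M"
      by (auto simp: module_hom_minus[OF assms, symmetric])
  next
    fix a b assume "a \<in> f ` carrier M" "b \<in> f ` carrier M"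
    thus "a \<oplus>\<^bsub>N\<^esub> b \<in> f ` carrier M"
      by (auto simp: module_hom_add[OF f, symmetric])
  next
    fix c a assume "c \<in> carrier k" "a \<in> f ` carrier M"
    thus "c \<odot>\<^bsub>N\<^esub> a \<in> f ` carrier M"
      by (auto simp: module_hom_smult[OF f, symmetric])
  qed
qed

lemma
  assumes "module k M" "S \<subseteq> carrier M"
  shows submodule_submodule_span: "submodule (submodule_span k M S) k M"
    and submodule_span_superset: "S \<subseteq> submodule_span k M S"
    and submodule_span_least: "\<lbrakk>submodule H k M; S \<subseteq> H\<rbrakk> \<Longrightarrow> submodule_span k M S \<subseteq> H"
proof -
  interpret M: module k M by fact
  note E = M.submoduleE
  have Z: "\<zero>\<^bsub>M\<^esub> \<in> H" if "submodule H k M" for H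
    by (rule submodule_zero_closed) fact
  show "submodule (submodule_span k M S) k M"
  proof (rule M.submoduleI)
    show "submodule_span k M S \<subseteq> carrier M"
      using M.carrier_is_submodule assms(2) by (auto simp: submodule_span_def)
  qed (auto simp: submodule_span_def E Z)
qed (auto simp: submodule_span_def)


section \<open>Quotient modules\<close>

lemma quot_module_simps:
  "carrier (M QuotM N) = (\<lambda>x. N +>\<^bsub>M\<^esub> x) ` carrier M"
  "\<zero>\<^bsub>M QuotM N\<^esub> = N"
  "add (M QuotM N) = set_add M"
  "mult (M QuotM N) = rcoset_mult M N"
  "\<one>\<^bsub>M QuotM N\<^esub> = N +>\<^bsub>M\<^esub> \<one>\<^bsub>M\<^esub>"
  "c \<odot>\<^bsub>M QuotM N\<^esub> C = (\<Union>x\<in>C. N +>\<^bsub>M\<^esub> (c \<odot>\<^bsub>M\<^esub> x))"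
  by (auto simp: quot_module_def ring.extend_def module.fields_def FactRing_def A_RCOSETS_def')

lemma submodule_abelian_subgroup:
  assumes "module k M" "submodule N k M"
  shows "abelian_subgroup N M"
  using assms by (intro abelian_subgroupI3 additive_subgroupI)
    (auto simp: submodule_def module_def)

lemma quot_module_smult_coset:
  assumes "module k M" "submodule N k M" "c \<in> carrier k" "x \<in> carrier M"
  shows "c \<odot>\<^bsub>M QuotM N\<^esub> (N +>\<^bsub>M\<^esub> x) = N +>\<^bsub>M\<^esub> (c \<odot>\<^bsub>M\<^esub> x)"
proof -
  interpret M: module k M by fact
  interpret N: abelian_subgroup N M by (rule submodule_abelian_subgroup) fact+
  have "N +>\<^bsub>M\<^esub> (c \<odot>\<^bsub>M\<^esub> y) = N +>\<^bsub>M\<^esub> (c \<odot>\<^bsub>M\<^esub> x)" if "y \<in> N +>\<^bsub>M\<^esub> x" for y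
  proof -
    from that obtain n where n: "n \<in> N" "y = n \<oplus>\<^bsub>M\<^esub> x"
      by (auto simp: a_r_coset_def')
    hence "c \<odot>\<^bsub>M\<^esub> y = c \<odot>\<^bsub>M\<^esub> n \<oplus>\<^bsub>M\<^esub> c \<odot>\<^bsub>M\<^esub> x"
      using assms by (simp add: M.smult_r_distr)
    hence "c \<odot>\<^bsub>M\<^esub> y \<in> N +>\<^bsub>M\<^esub> (c \<odot>\<^bsub>M\<^esub> x)"
      using M.submoduleE(4)[OF assms(2)] n assms(3) by (auto simp: a_r_coset_def')
    thus ?thesis using N.a_repr_independence' assms by auto
  qed
  hence "c \<odot>\<^bsub>M QuotM N\<^esub> (N +>\<^bsub>M\<^esub> x) = (\<Union>y\<in>N +>\<^bsub>M\<^esub> x. N +>\<^bsub>M\<^esub> (c \<odot>\<^bsub>M\<^esub> x))"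
    unfolding quot_module_simps by (rule SUP_cong[OF refl])
  moreover have "N +>\<^bsub>M\<^esub> x \<noteq> {}" using assms(4) N.a_rcos_self by blast
  ultimately show ?thesis by simp
qed

lemma quot_module_proj_linear:
  assumes "module k M" "submodule N k M"
  shows "(\<lambda>x. N +>\<^bsub>M\<^esub> x) \<in> module_hom k M (M QuotM N)"
proof -
  interpret M: module k M by fact
  interpret N: abelian_subgroup N M by (rule submodule_abelian_subgroup) fact+
  show ?thesis
    by (rule module_homI)
      (auto simp: quot_module_smult_coset[OF assms], auto simp: quot_module_simps N.a_rcos_sum)
qed

lemma module_quot_module:
  assumes "module k M" "submodule N k M"
  shows "module k (M QuotM N)"
proof -
  interpret M: module k M by fact
  interpret N: abelian_subgroup N M by (rule submodule_abelian_subgroup) fact+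
  note s = quot_module_smult_coset[OF assms]
  have a: "(N +>\<^bsub>M\<^esub> x) \<oplus>\<^bsub>M QuotM N\<^esub> (N +>\<^bsub>M\<^esub> y) = N +>\<^bsub>M\<^esub> (x \<oplus>\<^bsub>M\<^esub> y)"
    if "x \<in> carrier M" "y \<in> carrier M" for x y
    using that by (simp add: quot_module_simps N.a_rcos_sum)
  have z: "\<zero>\<^bsub>M QuotM N\<^esub> = N +>\<^bsub>M\<^esub> \<zero>\<^bsub>M\<^esub>"
    by (simp add: quot_module_simps N.a_subset)
  have "abelian_group (M QuotM N)"
  proof (rule abelian_groupI)
    fix C assume "C \<in> carrier (M QuotM N)"
    then obtain x where x: "x \<in> carrier M" "C = N +>\<^bsub>M\<^esub> x" by (auto simp: quot_module_simps)
    hence "N +>\<^bsub>M\<^esub> (\<ominus>\<^bsub>M\<^esub> x) \<in> carrier (M QuotM N)"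
      "(N +>\<^bsub>M\<^esub> (\<ominus>\<^bsub>M\<^esub> x)) \<oplus>\<^bsub>M QuotM N\<^esub> C = \<zero>\<^bsub>M QuotM N\<^esub>"
      by (auto simp: quot_module_simps(1) a z M.M.l_neg)
    thus "\<exists>D\<in>carrier (M QuotM N). D \<oplus>\<^bsub>M QuotM N\<^esub> C = \<zero>\<^bsub>M QuotM N\<^esub>" by blast
  qed (auto simp: quot_module_simps(1) a z M.M.a_ac)
  show ?thesis
  proof (rule moduleI)
    show "cring k" by (rule M.R.cring_axioms)
  qed (fact, auto simp: quot_module_simps(1) s a M.smult_l_distr M.smult_r_distr M.smult_assoc1)
qed

lemma quot_module_proj_zero:
  assumes "module k M" "submodule N k M" "x \<in> N"
  shows "N +>\<^bsub>M\<^esub> x = \<zero>\<^bsub>M QuotM N\<^esub>"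
proof -
  interpret N: abelian_subgroup N M by (rule submodule_abelian_subgroup) fact+
  show ?thesis using assms by (simp add: quot_module_simps N.a_rcos_const)
qed


lemma quot_module_proj_eqI:
  assumes "module k M" "submodule N k M" "x \<in> carrier M" "y \<in> carrier M" "x \<ominus>\<^bsub>M\<^esub> y \<in> N"
  shows "N +>\<^bsub>M\<^esub> x = N +>\<^bsub>M\<^esub> y"
proof -
  interpret N: abelian_subgroup N M by (rule submodule_abelian_subgroup) fact+
  have "x \<in> N +>\<^bsub>M\<^esub> y" using assms by (simp add: N.a_rcos_module a_minus_def)
  thus ?thesis using N.a_repr_independence' assms by auto
qed


section \<open>Free modules\<close>

lemma module_free_module:
  assumes "cring k"
  shows "module k (free_module k S)"
proof -
  interpret cring k by fact
  let ?F = "free_module k S"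
  have c: "\<phi> \<in> carrier ?F \<longleftrightarrow> (\<forall>s. \<phi> s \<in> carrier k) \<and> finite {s. \<phi> s \<noteq> \<zero>\<^bsub>k\<^esub>} \<and>
    (\<forall>s. s \<notin> S \<longrightarrow> \<phi> s = \<zero>\<^bsub>k\<^esub>)" for \<phi>
    by (auto simp: free_module_def)
  have o: "\<phi> \<oplus>\<^bsub>?F\<^esub> \<psi> = (\<lambda>s. \<phi> s \<oplus>\<^bsub>k\<^esub> \<psi> s)" "\<zero>\<^bsub>?F\<^esub> = (\<lambda>s. \<zero>\<^bsub>k\<^esub>)"
    "a \<odot>\<^bsub>?F\<^esub> \<phi> = (\<lambda>s. a \<otimes>\<^bsub>k\<^esub> \<phi> s)" for \<phi> \<psi> a
    by (auto simp: free_module_def)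
  have add: "\<phi> \<oplus>\<^bsub>?F\<^esub> \<psi> \<in> carrier ?F" if "\<phi> \<in> carrier ?F" "\<psi> \<in> carrier ?F" for \<phi> \<psi>
    using that unfolding c o
    by (auto intro: finite_subset[of _ "{s. \<phi> s \<noteq> \<zero>\<^bsub>k\<^esub>} \<union> {s. \<psi> s \<noteq> \<zero>\<^bsub>k\<^esub>}"])
  have sm: "a \<odot>\<^bsub>?F\<^esub> \<phi> \<in> carrier ?F" if "\<phi> \<in> carrier ?F" "a \<in> carrier k" for a \<phi>
    using that unfolding c o by (auto intro: finite_subset[of _ "{s. \<phi> s \<noteq> \<zero>\<^bsub>k\<^esub>}"])
  have "abelian_group ?F"
  proof (rule abelian_groupI)
    fix \<phi> assume p: "\<phi> \<in> carrier ?F"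
    have "(\<ominus>\<^bsub>k\<^esub> \<one>\<^bsub>k\<^esub>) \<odot>\<^bsub>?F\<^esub> \<phi> \<oplus>\<^bsub>?F\<^esub> \<phi> = \<zero>\<^bsub>?F\<^esub>"
      using p unfolding o c by (auto simp: fun_eq_iff l_minus l_neg)
    with sm[OF p, of "\<ominus>\<^bsub>k\<^esub> \<one>\<^bsub>k\<^esub>"] show "\<exists>\<psi>\<in>carrier ?F. \<psi> \<oplus>\<^bsub>?F\<^esub> \<phi> = \<zero>\<^bsub>?F\<^esub>" by blast
  qed (auto simp: add, auto simp: o c a_ac)
  thus ?thesis
    by (intro moduleI) (auto simp: sm assms, auto simp: o c l_distr r_distr m_assoc)
qed

lemma free_gen_closed: "\<lbrakk>cring k; s \<in> S\<rbrakk> \<Longrightarrow> free_gen k s \<in> carrier (free_module k S)"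
proof -
  assume "cring k" "s \<in> S"
  then interpret cring k by simp
  show ?thesis using \<open>s \<in> S\<close> by (auto simp: free_module_def free_gen_def)
qed

text \<open>
  A finitely supported function is reduced to the zero function by clearing its values one at a
  time, and each step subtracts a multiple of a generator.
\<close>

lemma free_module_spanned:
  assumes "cring k" and H: "submodule H k (free_module k S)"
    and gen: "\<And>s. s \<in> S \<Longrightarrow> free_gen k s \<in> H"
  shows "H = carrier (free_module k S)"
proof -
  interpret cring k by fact
  let ?F = "free_module k S"
  interpret F: module k ?F using assms(1) by (rule module_free_module)
  note E = F.submoduleE[OF H]
  have "\<phi> \<in> H" if "finite T" "\<phi> \<in> carrier ?F" "{s. \<phi> s \<noteq> \<zero>\<^bsub>k\<^esub>} = T" for T \<phi>
    using that
  proof (induction T arbitrary: \<phi> rule: finite_induct)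
    case empty
    hence "\<phi> = \<zero>\<^bsub>?F\<^esub>" by (auto simp: free_module_def)
    thus ?case using submodule_zero_closed[OF H] by simp
  next
    case (insert s T)
    let ?\<psi> = "\<phi>(s := \<zero>\<^bsub>k\<^esub>)"
    have c: "range \<phi> \<subseteq> carrier k" and s: "s \<in> S"
      and fin: "finite {s. \<phi> s \<noteq> \<zero>\<^bsub>k\<^esub>}" "{s. \<phi> s \<noteq> \<zero>\<^bsub>k\<^esub>} \<subseteq> S"
      using insert by (auto simp: free_module_def)
    have T: "{t. ?\<psi> t \<noteq> \<zero>\<^bsub>k\<^esub>} = T" using insert by auto
    moreover have "?\<psi> \<in> carrier ?F"
      using c fin T insert.hyps by (auto simp: free_module_def subset_iff simp del: fun_upd_apply)
        (auto split: if_splits)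
    ultimately have "?\<psi> \<in> H" using insert.IH by blast
    moreover have "\<phi> s \<odot>\<^bsub>?F\<^esub> free_gen k s \<in> H" using c gen[OF s] by (intro E(4)) auto
    moreover have "\<phi> = ?\<psi> \<oplus>\<^bsub>?F\<^esub> \<phi> s \<odot>\<^bsub>?F\<^esub> free_gen k s"
      using c by (auto simp: free_module_def free_gen_def fun_eq_iff image_subset_iff)
    ultimately show ?case using E(5) by metis
  qed
  thus ?thesis using E(1) by (auto simp: free_module_def)
qed

text \<open>
  The linear extension of \<open>b\<close> from the basis \<open>S\<close> to the free module on \<open>S\<close>.
\<close>

definition linear_combination :: "('k, 'r) ring_scheme \<Rightarrow> ('k, 'c, 'p) module_scheme
    \<Rightarrow> ('s \<Rightarrow> 'c) \<Rightarrow> ('s \<Rightarrow> 'k) \<Rightarrow> 'c"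
  where "linear_combination k P b \<phi> = (\<Oplus>\<^bsub>P\<^esub>s\<in>{s. \<phi> s \<noteq> \<zero>\<^bsub>k\<^esub>}. \<phi> s \<odot>\<^bsub>P\<^esub> b s)"

text \<open>
  The supports of \<open>\<phi>\<close>, \<open>\<psi>\<close> and \<open>\<phi> + \<psi>\<close> differ, so additivity can only be read off after the sums
  have been extended to a common finite index set.
\<close>

lemma linear_combination_superset:
  assumes "module k P" and b: "b \<in> S \<rightarrow> carrier P"
    and "\<phi> \<in> carrier (free_module k S)" and "finite T" "{s. \<phi> s \<noteq> \<zero>\<^bsub>k\<^esub>} \<subseteq> T" "T \<subseteq> S"
  shows "linear_combination k P b \<phi> = (\<Oplus>\<^bsub>P\<^esub>s\<in>T. \<phi> s \<odot>\<^bsub>P\<^esub> b s)"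
proof -
  interpret P: module k P by fact
  have "\<phi> s \<in> carrier k" for s using assms(3) by (auto simp: free_module_def)
  thus ?thesis unfolding linear_combination_def
    using assms by (intro P.M.add.finprod_mono_neutral_cong_left) (auto simp: subset_iff Pi_iff)
qed

lemma linear_combination_linear:
  assumes "module k P" and b: "b \<in> S \<rightarrow> carrier P"
  shows "linear_combination k P b \<in> module_hom k (free_module k S) P"
proof -
  interpret P: module k P by fact
  let ?F = "free_module k S"
  interpret F: module k ?F by (rule module_free_module) (rule P.R.cring_axioms)
  note sup = linear_combination_superset[OF assms]
  have c: "\<phi> s \<in> carrier k" if "\<phi> \<in> carrier ?F" for \<phi> s
    using that by (auto simp: free_module_def)
  have fin: "finite {s. \<phi> s \<noteq> \<zero>\<^bsub>k\<^esub>}" "{s. \<phi> s \<noteq> \<zero>\<^bsub>k\<^esub>} \<subseteq> S" if "\<phi> \<in> carrier ?F" for \<phi>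
    using that by (auto simp: free_module_def)
  show ?thesis
  proof (rule module_homI)
    fix \<phi> assume p: "\<phi> \<in> carrier ?F"
    show "linear_combination k P b \<phi> \<in> carrier P"
      unfolding linear_combination_def
      using c[OF p] fin[OF p] b by (intro P.M.finsum_closed) auto
  next
    fix \<phi> \<psi> assume p: "\<phi> \<in> carrier ?F" and q: "\<psi> \<in> carrier ?F"
    let ?T = "{s. \<phi> s \<noteq> \<zero>\<^bsub>k\<^esub>} \<union> {s. \<psi> s \<noteq> \<zero>\<^bsub>k\<^esub>}"
    have T: "finite ?T" "?T \<subseteq> S" using fin[OF p] fin[OF q] by auto
    have "linear_combination k P b (\<phi> \<oplus>\<^bsub>?F\<^esub> \<psi>) = (\<Oplus>\<^bsub>P\<^esub>s\<in>?T. (\<phi> \<oplus>\<^bsub>?F\<^esub> \<psi>) s \<odot>\<^bsub>P\<^esub> b s)"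
      by (rule sup) (use p q T in \<open>auto\<close>, auto simp: free_module_def)
    also have "\<dots> = (\<Oplus>\<^bsub>P\<^esub>s\<in>?T. \<phi> s \<odot>\<^bsub>P\<^esub> b s \<oplus>\<^bsub>P\<^esub> \<psi> s \<odot>\<^bsub>P\<^esub> b s)"
      using T(2) b c[OF p] c[OF q]
      by (intro P.M.finsum_cong') (auto simp: free_module_def P.smult_l_distr subset_iff Pi_iff)
    also have "\<dots> = (\<Oplus>\<^bsub>P\<^esub>s\<in>?T. \<phi> s \<odot>\<^bsub>P\<^esub> b s) \<oplus>\<^bsub>P\<^esub> (\<Oplus>\<^bsub>P\<^esub>s\<in>?T. \<psi> s \<odot>\<^bsub>P\<^esub> b s)"
      using T(2) b c[OF p] c[OF q] by (intro P.M.finsum_addf) (auto simp: subset_iff Pi_iff)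
    also have "\<dots> = linear_combination k P b \<phi> \<oplus>\<^bsub>P\<^esub> linear_combination k P b \<psi>"
      using sup[OF p T(1) _ T(2)] sup[OF q T(1) _ T(2)] by simp
    finally show "linear_combination k P b (\<phi> \<oplus>\<^bsub>?F\<^esub> \<psi>) =
      linear_combination k P b \<phi> \<oplus>\<^bsub>P\<^esub> linear_combination k P b \<psi>" .
  next
    fix a \<phi> assume a: "a \<in> carrier k" and p: "\<phi> \<in> carrier ?F"
    let ?T = "{s. \<phi> s \<noteq> \<zero>\<^bsub>k\<^esub>}"
    note T = fin[OF p]
    have "linear_combination k P b (a \<odot>\<^bsub>?F\<^esub> \<phi>) = (\<Oplus>\<^bsub>P\<^esub>s\<in>?T. (a \<odot>\<^bsub>?F\<^esub> \<phi>) s \<odot>\<^bsub>P\<^esub> b s)"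
      by (rule sup) (use p T a in \<open>auto\<close>, auto simp: free_module_def)
    also have "\<dots> = (\<Oplus>\<^bsub>P\<^esub>s\<in>?T. a \<odot>\<^bsub>P\<^esub> (\<phi> s \<odot>\<^bsub>P\<^esub> b s))"
      using T(2) a b c[OF p]
      by (intro P.M.finsum_cong') (auto simp: free_module_def P.smult_assoc1 subset_iff Pi_iff)
    also have "\<dots> = a \<odot>\<^bsub>P\<^esub> linear_combination k P b \<phi>"
      unfolding linear_combination_def
      using T a b c[OF p] by (intro P.finsum_smult_ldistr[symmetric]) auto
    finally show "linear_combination k P b (a \<odot>\<^bsub>?F\<^esub> \<phi>) = a \<odot>\<^bsub>P\<^esub> linear_combination k P b \<phi>" .
  qed
qed

lemma linear_combination_free_gen:
  assumes "module k P" "b \<in> S \<rightarrow> carrier P" "s \<in> S"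
  shows "linear_combination k P b (free_gen k s) = b s"
proof -
  interpret P: module k P by fact
  have "linear_combination k P b (free_gen k s) = (\<Oplus>\<^bsub>P\<^esub>t\<in>{s}. free_gen k s t \<odot>\<^bsub>P\<^esub> b t)"
    using assms by (intro linear_combination_superset free_gen_closed P.R.cring_axioms)
      (auto simp: free_gen_def)
  also have "\<dots> = b s" using assms by (simp add: free_gen_def Pi_iff)
  finally show ?thesis .
qed


section \<open>Tensor products\<close>

definition bilinear_maps :: "('k, 'r) ring_scheme \<Rightarrow> ('k, 'a, 'm) module_scheme
    \<Rightarrow> ('k, 'b, 'n) module_scheme \<Rightarrow> ('k, 'c, 'p) module_scheme \<Rightarrow> ('a \<Rightarrow> 'b \<Rightarrow> 'c) set"
  where "bilinear_maps k M N P = {\<beta>.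
    (\<forall>y\<in>carrier N. (\<lambda>x. \<beta> x y) \<in> module_hom k M P) \<and>
    (\<forall>x\<in>carrier M. (\<lambda>y. \<beta> x y) \<in> module_hom k N P)}"

lemma bilinear_mapsI:
  assumes "\<And>y. y \<in> carrier N \<Longrightarrow> (\<lambda>x. \<beta> x y) \<in> module_hom k M P"
    and "\<And>x. x \<in> carrier M \<Longrightarrow> (\<lambda>y. \<beta> x y) \<in> module_hom k N P"
  shows "\<beta> \<in> bilinear_maps k M N P"
  using assms by (simp add: bilinear_maps_def)

lemma
  assumes "\<beta> \<in> bilinear_maps k M N P"
  shows bilinear_maps_left: "y \<in> carrier N \<Longrightarrow> (\<lambda>x. \<beta> x y) \<in> module_hom k M P"
    and bilinear_maps_right: "x \<in> carrier M \<Longrightarrow> (\<lambda>y. \<beta> x y) \<in> module_hom k N P"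
  using assms by (auto simp: bilinear_maps_def)

lemma bilinear_maps_closed:
  "\<lbrakk>\<beta> \<in> bilinear_maps k M N P; x \<in> carrier M; y \<in> carrier N\<rbrakk> \<Longrightarrow> \<beta> x y \<in> carrier P"
  by (rule module_hom_closed[OF bilinear_maps_left])

lemma bilinear_maps_Pi:
  assumes "\<beta> \<in> bilinear_maps k M N P"
  shows "(\<lambda>s. \<beta> (fst s) (snd s)) \<in> carrier M \<times> carrier N \<rightarrow> carrier P"
  using assms by (auto simp: bilinear_maps_closed)

context
  fixes k :: "('k, 'r) ring_scheme"
    and M :: "('k, 'a, 'm) module_scheme" and N :: "('k, 'b, 'n) module_scheme"
  assumes M: "module k M" and N: "module k N"
begin

interpretation M: module k M by (fact M)
interpretation N: module k N by (fact N)

abbreviation (input) "free_pairs \<equiv> free_module k (carrier M \<times> carrier N)"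

interpretation FP: module k free_pairs by (rule module_free_module) (rule M.R.cring_axioms)

lemma free_gen_pair_closed:
  "\<lbrakk>x \<in> carrier M; y \<in> carrier N\<rbrakk> \<Longrightarrow> free_gen k (x, y) \<in> carrier free_pairs"
  by (rule free_gen_closed) (auto intro: M.R.cring_axioms)

lemma tensor_relations_closed: "tensor_relations k M N \<subseteq> carrier free_pairs"
  by (auto simp: tensor_relations_def Let_def free_gen_pair_closed)

lemma tensor_relationsI:
  "\<lbrakk>x \<in> carrier M; x' \<in> carrier M; y \<in> carrier N\<rbrakk> \<Longrightarrow>
    free_gen k (x \<oplus>\<^bsub>M\<^esub> x', y) \<ominus>\<^bsub>free_pairs\<^esub> (free_gen k (x, y) \<oplus>\<^bsub>free_pairs\<^esub> free_gen k (x', y))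
      \<in> tensor_relations k M N"
  "\<lbrakk>x \<in> carrier M; y \<in> carrier N; y' \<in> carrier N\<rbrakk> \<Longrightarrow>
    free_gen k (x, y \<oplus>\<^bsub>N\<^esub> y') \<ominus>\<^bsub>free_pairs\<^esub> (free_gen k (x, y) \<oplus>\<^bsub>free_pairs\<^esub> free_gen k (x, y'))
      \<in> tensor_relations k M N"
  "\<lbrakk>c \<in> carrier k; x \<in> carrier M; y \<in> carrier N\<rbrakk> \<Longrightarrow>
    free_gen k (c \<odot>\<^bsub>M\<^esub> x, y) \<ominus>\<^bsub>free_pairs\<^esub> (c \<odot>\<^bsub>free_pairs\<^esub> free_gen k (x, y))
      \<in> tensor_relations k M N"
  "\<lbrakk>c \<in> carrier k; x \<in> carrier M; y \<in> carrier N\<rbrakk> \<Longrightarrow>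
    free_gen k (x, c \<odot>\<^bsub>N\<^esub> y) \<ominus>\<^bsub>free_pairs\<^esub> (c \<odot>\<^bsub>free_pairs\<^esub> free_gen k (x, y))
      \<in> tensor_relations k M N"
  unfolding tensor_relations_def Let_def by blast+

lemma submodule_tensor_kernel: "submodule (tensor_kernel k M N) k free_pairs"
  unfolding tensor_kernel_def
  by (rule submodule_submodule_span) (fact FP.module_axioms tensor_relations_closed)+

lemma module_tensor: "module k (tensor k M N)"
  unfolding tensor_def
  by (rule module_quot_module) (fact FP.module_axioms submodule_tensor_kernel)+

lemma tensor_proj_linear:
  "(\<lambda>\<phi>. tensor_kernel k M N +>\<^bsub>free_pairs\<^esub> \<phi>) \<in> module_hom k free_pairs (tensor k M N)"
  unfolding tensor_def
  by (rule quot_module_proj_linear) (fact FP.module_axioms submodule_tensor_kernel)+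

lemma pure_tensor_closed:
  "\<lbrakk>x \<in> carrier M; y \<in> carrier N\<rbrakk> \<Longrightarrow> pure_tensor k M N x y \<in> carrier (tensor k M N)"
  unfolding pure_tensor_def by (intro module_hom_closed[OF tensor_proj_linear] free_gen_pair_closed)

lemma pure_tensor_bilinear: "pure_tensor k M N \<in> bilinear_maps k M N (tensor k M N)"
proof -
  let ?\<pi> = "\<lambda>\<phi>. tensor_kernel k M N +>\<^bsub>free_pairs\<^esub> \<phi>"
  have rel: "?\<pi> u = ?\<pi> v"
    if "u \<in> carrier free_pairs" "v \<in> carrier free_pairs" "u \<ominus>\<^bsub>free_pairs\<^esub> v \<in> tensor_relations k M N" for u v
    using that(3) submodule_span_superset[OF FP.module_axioms tensor_relations_closed]
    by (intro quot_module_proj_eqI[OF FP.module_axioms submodule_tensor_kernel] that(1,2))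
      (auto simp: tensor_kernel_def)
  note lin = module_hom_add[OF tensor_proj_linear, symmetric]
    module_hom_smult[OF tensor_proj_linear, symmetric]
  show ?thesis
  proof (intro bilinear_mapsI module_homI)
    fix x x' y assume "y \<in> carrier N" "x \<in> carrier M" "x' \<in> carrier M"
    thus "pure_tensor k M N (x \<oplus>\<^bsub>M\<^esub> x') y =
        pure_tensor k M N x y \<oplus>\<^bsub>tensor k M N\<^esub> pure_tensor k M N x' y"
      unfolding pure_tensor_def
      by (simp add: lin free_gen_pair_closed rel[OF _ _ tensor_relationsI(1)])
  next
    fix x y y' assume "x \<in> carrier M" "y \<in> carrier N" "y' \<in> carrier N"
    thus "pure_tensor k M N x (y \<oplus>\<^bsub>N\<^esub> y') =
        pure_tensor k M N x y \<oplus>\<^bsub>tensor k M N\<^esub> pure_tensor k M N x y'"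
      unfolding pure_tensor_def
      by (simp add: lin free_gen_pair_closed rel[OF _ _ tensor_relationsI(2)])
  next
    fix c x y assume "y \<in> carrier N" "c \<in> carrier k" "x \<in> carrier M"
    thus "pure_tensor k M N (c \<odot>\<^bsub>M\<^esub> x) y = c \<odot>\<^bsub>tensor k M N\<^esub> pure_tensor k M N x y"
      unfolding pure_tensor_def
      by (simp add: lin free_gen_pair_closed rel[OF _ _ tensor_relationsI(3)])
  next
    fix c x y assume "x \<in> carrier M" "c \<in> carrier k" "y \<in> carrier N"
    thus "pure_tensor k M N x (c \<odot>\<^bsub>N\<^esub> y) = c \<odot>\<^bsub>tensor k M N\<^esub> pure_tensor k M N x y"
      unfolding pure_tensor_def
      by (simp add: lin free_gen_pair_closed rel[OF _ _ tensor_relationsI(4)])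
  qed (auto intro: pure_tensor_closed)
qed

text \<open>
  The preimage of \<open>H\<close> in the free module contains all generators, so it is the whole free module,
  which projects onto the tensor product.
\<close>

lemma tensor_spanned_by_pure_tensors:
  assumes H: "submodule H k (tensor k M N)"
    and pure: "\<And>x y. \<lbrakk>x \<in> carrier M; y \<in> carrier N\<rbrakk> \<Longrightarrow> pure_tensor k M N x y \<in> H"
  shows "H = carrier (tensor k M N)"
proof -
  interpret T: module k "tensor k M N" by (rule module_tensor)
  have "{\<phi> \<in> carrier free_pairs. tensor_kernel k M N +>\<^bsub>free_pairs\<^esub> \<phi> \<in> H} = carrier free_pairs"
    using pure
    by (intro free_module_spanned M.R.cring_axioms
        submodule_vimage[OF FP.module_axioms module_tensor tensor_proj_linear H])
      (auto simp: free_gen_pair_closed pure_tensor_def)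
  hence "(\<lambda>\<phi>. tensor_kernel k M N +>\<^bsub>free_pairs\<^esub> \<phi>) ` carrier free_pairs \<subseteq> H" by auto
  moreover have "carrier (tensor k M N) = (\<lambda>\<phi>. tensor_kernel k M N +>\<^bsub>free_pairs\<^esub> \<phi>) ` carrier free_pairs"
    by (simp add: tensor_def quot_module_simps)
  ultimately show ?thesis using T.submoduleE(1)[OF H] by simp
qed

lemma tensor_hom_eqI:
  assumes "module k P" "f \<in> module_hom k (tensor k M N) P" "g \<in> module_hom k (tensor k M N) P"
    and "\<And>x y. \<lbrakk>x \<in> carrier M; y \<in> carrier N\<rbrakk> \<Longrightarrow> f (pure_tensor k M N x y) = g (pure_tensor k M N x y)"
    and "t \<in> carrier (tensor k M N)"
  shows "f t = g t"
proof -
  have "{t \<in> carrier (tensor k M N). f t = g t} = carrier (tensor k M N)"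
    using assms by (intro tensor_spanned_by_pure_tensors submodule_equalizer module_tensor)
      (auto simp: pure_tensor_closed)
  thus ?thesis using assms(5) by blast
qed

text \<open>
  The linear extension of \<open>\<beta>\<close> to the free module annihilates the defining relations precisely
  because \<open>\<beta>\<close> is bilinear. It is therefore constant on every coset, and the representative that
  \<^const>\<open>tensor_lift\<close> picks may be replaced by any other.
\<close>

lemma tensor_lift_coset:
  assumes P: "module k P" and \<beta>: "\<beta> \<in> bilinear_maps k M N P" and \<phi>: "\<phi> \<in> carrier free_pairs"
  shows "tensor_lift k P \<beta> (tensor_kernel k M N +>\<^bsub>free_pairs\<^esub> \<phi>) =
    linear_combination k P (\<lambda>s. \<beta> (fst s) (snd s)) \<phi>"
proof -
  interpret P: module k P by fact
  interpret K: abelian_subgroup "tensor_kernel k M N" free_pairs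
    by (rule submodule_abelian_subgroup) (fact FP.module_axioms submodule_tensor_kernel)+
  let ?L = "linear_combination k P (\<lambda>s. \<beta> (fst s) (snd s))"
  have b: "(\<lambda>s. \<beta> (fst s) (snd s)) \<in> carrier M \<times> carrier N \<rightarrow> carrier P"
    by (rule bilinear_maps_Pi[OF \<beta>])
  have L: "?L \<in> module_hom k free_pairs P" by (rule linear_combination_linear[OF P b])
  have gen: "?L (free_gen k (x, y)) = \<beta> x y" if "x \<in> carrier M" "y \<in> carrier N" for x y
    using linear_combination_free_gen[OF P b, of "(x, y)"] that by simp
  have Lm: "?L (u \<ominus>\<^bsub>free_pairs\<^esub> v) = \<zero>\<^bsub>P\<^esub>"
    if "u \<in> carrier free_pairs" "v \<in> carrier free_pairs" "?L u = ?L v" for u v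
    using that module_hom_closed[OF L]
    by (simp add: a_minus_def module_hom_add[OF L] module_hom_minus[OF FP.module_axioms P L] P.M.r_neg)
  have zero: "(\<lambda>_. \<zero>\<^bsub>P\<^esub>) \<in> module_hom k free_pairs P" by (rule module_homI) auto
  note lin = module_hom_add[OF L] module_hom_smult[OF L] gen
    module_hom_add[OF bilinear_maps_left[OF \<beta>]] module_hom_smult[OF bilinear_maps_left[OF \<beta>]]
    module_hom_add[OF bilinear_maps_right[OF \<beta>]] module_hom_smult[OF bilinear_maps_right[OF \<beta>]]
  have "tensor_relations k M N \<subseteq> {\<phi> \<in> carrier free_pairs. ?L \<phi> = \<zero>\<^bsub>P\<^esub>}"
    by (auto simp: tensor_relations_def Let_def free_gen_pair_closed lin intro!: Lm)
  hence ker: "tensor_kernel k M N \<subseteq> {\<phi> \<in> carrier free_pairs. ?L \<phi> = \<zero>\<^bsub>P\<^esub>}"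
    unfolding tensor_kernel_def
    by (intro submodule_span_least[OF FP.module_axioms tensor_relations_closed]
        submodule_equalizer[OF FP.module_axioms P L zero])
  have "?L \<psi> = ?L \<phi>" if "\<psi> \<in> tensor_kernel k M N +>\<^bsub>free_pairs\<^esub> \<phi>" for \<psi>
  proof -
    obtain \<kappa> where \<kappa>: "\<kappa> \<in> tensor_kernel k M N" "\<psi> = \<kappa> \<oplus>\<^bsub>free_pairs\<^esub> \<phi>"
      using \<open>\<psi> \<in> _\<close> by (auto simp: a_r_coset_def')
    hence "?L \<psi> = ?L \<kappa> \<oplus>\<^bsub>P\<^esub> ?L \<phi>" using \<phi> by (simp add: module_hom_add[OF L])
    also have "?L \<kappa> = \<zero>\<^bsub>P\<^esub>" using \<kappa> ker by auto
    finally show ?thesis using \<phi> by (simp add: module_hom_closed[OF L])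
  qed
  moreover have "(SOME \<psi>. \<psi> \<in> tensor_kernel k M N +>\<^bsub>free_pairs\<^esub> \<phi>) \<in> tensor_kernel k M N +>\<^bsub>free_pairs\<^esub> \<phi>"
    unfolding some_in_eq using K.a_rcos_self[OF \<phi>] by (rule ex_in_conv[THEN iffD1, OF exI])
  ultimately show ?thesis unfolding tensor_lift_def Let_def linear_combination_def by blast
qed

lemma tensor_lift_linear:
  assumes P: "module k P" and \<beta>: "\<beta> \<in> bilinear_maps k M N P"
  shows "tensor_lift k P \<beta> \<in> module_hom k (tensor k M N) P"
proof -
  let ?\<pi> = "\<lambda>\<phi>. tensor_kernel k M N +>\<^bsub>free_pairs\<^esub> \<phi>"
  have b: "(\<lambda>s. \<beta> (fst s) (snd s)) \<in> carrier M \<times> carrier N \<rightarrow> carrier P"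
    by (rule bilinear_maps_Pi[OF \<beta>])
  have carr: "carrier (tensor k M N) = ?\<pi> ` carrier free_pairs"
    by (simp add: tensor_def quot_module_simps)
  note L = linear_combination_linear[OF P b] 
  note c = tensor_lift_coset[OF P \<beta>]
  note lin = module_hom_add[OF tensor_proj_linear, symmetric]
    module_hom_smult[OF tensor_proj_linear, symmetric]
  show ?thesis
    by (rule module_homI) (auto simp: carr lin c module_homD[OF L])
qed

lemma tensor_lift_pure_tensor:
  assumes P: "module k P" and \<beta>: "\<beta> \<in> bilinear_maps k M N P"
    and "x \<in> carrier M" "y \<in> carrier N"
  shows "tensor_lift k P \<beta> (pure_tensor k M N x y) = \<beta> x y"
proof -
  have "(\<lambda>s. \<beta> (fst s) (snd s)) \<in> carrier M \<times> carrier N \<rightarrow> carrier P"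
    by (rule bilinear_maps_Pi[OF \<beta>])
  from linear_combination_free_gen[OF P this, of "(x, y)"] show ?thesis
    using assms unfolding pure_tensor_def by (simp add: tensor_lift_coset free_gen_pair_closed)
qed

end


section \<open>Maps between tensor products\<close>

lemma bilinear_maps_pullback:
  assumes "\<beta> \<in> bilinear_maps k M' N' P" and f: "f \<in> module_hom k M M'" and g: "g \<in> module_hom k N N'"
  shows "(\<lambda>x y. \<beta> (f x) (g y)) \<in> bilinear_maps k M N P"
  using module_hom_compose[OF f bilinear_maps_left[OF assms(1)]]
    module_hom_compose[OF g bilinear_maps_right[OF assms(1)]]
  by (auto intro: bilinear_mapsI simp: module_hom_closed[OF f] module_hom_closed[OF g])

context
  fixes k :: "('k, 'r) ring_scheme"
    and M :: "('k, 'a, 'm) module_scheme" and N :: "('k, 'b, 'n) module_scheme"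
    and M' :: "('k, 'c, 'p) module_scheme" and N' :: "('k, 'd, 'q) module_scheme"
    and f :: "'a \<Rightarrow> 'c" and g :: "'b \<Rightarrow> 'd"
  assumes modules: "module k M" "module k N" "module k M'" "module k N'"
    and f: "f \<in> module_hom k M M'" and g: "g \<in> module_hom k N N'"
begin

lemma tensor_map_linear:
  "tensor_map k M' N' f g \<in> module_hom k (tensor k M N) (tensor k M' N')"
  unfolding tensor_map_def
  by (intro tensor_lift_linear modules module_tensor bilinear_maps_pullback[OF _ f g]
      pure_tensor_bilinear)

lemma tensor_map_pure_tensor:
  "\<lbrakk>x \<in> carrier M; y \<in> carrier N\<rbrakk> \<Longrightarrow>
    tensor_map k M' N' f g (pure_tensor k M N x y) = pure_tensor k M' N' (f x) (g y)"
  unfolding tensor_map_def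
  by (intro tensor_lift_pure_tensor modules module_tensor bilinear_maps_pullback[OF _ f g]
      pure_tensor_bilinear)

lemma tensor_map_surj:
  assumes "f ` carrier M = carrier M'" "g ` carrier N = carrier N'"
  shows "tensor_map k M' N' f g ` carrier (tensor k M N) = carrier (tensor k M' N')"
proof (rule tensor_spanned_by_pure_tensors)
  show "submodule (tensor_map k M' N' f g ` carrier (tensor k M N)) k (tensor k M' N')"
    by (intro submodule_image module_tensor modules tensor_map_linear)
  fix x' y' assume "x' \<in> carrier M'" "y' \<in> carrier N'"
  then obtain x y where "x \<in> carrier M" "y \<in> carrier N" "x' = f x" "y' = g y"
    using assms by blast
  thus "pure_tensor k M' N' x' y' \<in> tensor_map k M' N' f g ` carrier (tensor k M N)"
    using modules by (auto simp: tensor_map_pure_tensor[symmetric] pure_tensor_closed)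
qed (fact modules)+

end

text \<open>
  Functoriality of \<open>\<otimes>\<close>, stated for two factorizations \<open>f1' \<circ> f1 = f2' \<circ> f2\<close> and
  \<open>g1' \<circ> g1 = g2' \<circ> g2\<close> at once. In this form it moves tensor powers
  of \<open>p\<close> past \<open>\<Delta> \<otimes> 1\<close> or \<open>1 \<otimes> m\<close> in a single step.
\<close>

lemma tensor_map_commuting_squares:
  assumes modules: "module k M" "module k N" "module k M1" "module k N1"
    "module k M2" "module k N2" "module k M3" "module k N3"
    and f: "f1 \<in> module_hom k M M1" "f1' \<in> module_hom k M1 M3"
      "f2 \<in> module_hom k M M2" "f2' \<in> module_hom k M2 M3"
    and g: "g1 \<in> module_hom k N N1" "g1' \<in> module_hom k N1 N3"
      "g2 \<in> module_hom k N N2" "g2' \<in> module_hom k N2 N3"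
    and fcomm: "\<And>x. x \<in> carrier M \<Longrightarrow> f1' (f1 x) = f2' (f2 x)"
    and gcomm: "\<And>y. y \<in> carrier N \<Longrightarrow> g1' (g1 y) = g2' (g2 y)"
    and t: "t \<in> carrier (tensor k M N)"
  shows "tensor_map k M3 N3 f1' g1' (tensor_map k M1 N1 f1 g1 t) =
    tensor_map k M3 N3 f2' g2' (tensor_map k M2 N2 f2 g2 t)"
proof (rule tensor_hom_eqI[OF modules(1,2) module_tensor[OF modules(7,8)] _ _ _ t])
  show "(\<lambda>t. tensor_map k M3 N3 f1' g1' (tensor_map k M1 N1 f1 g1 t))
      \<in> module_hom k (tensor k M N) (tensor k M3 N3)"
    by (rule module_hom_compose; rule tensor_map_linear; fact)
  show "(\<lambda>t. tensor_map k M3 N3 f2' g2' (tensor_map k M2 N2 f2 g2 t))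
      \<in> module_hom k (tensor k M N) (tensor k M3 N3)"
    by (rule module_hom_compose; rule tensor_map_linear; fact)
  fix x y assume "x \<in> carrier M" "y \<in> carrier N"
  thus "tensor_map k M3 N3 f1' g1' (tensor_map k M1 N1 f1 g1 (pure_tensor k M N x y)) =
      tensor_map k M3 N3 f2' g2' (tensor_map k M2 N2 f2 g2 (pure_tensor k M N x y))"
    using modules f g
    by (simp add: tensor_map_pure_tensor[where M=M and N=N]
        tensor_map_pure_tensor[where M=M1 and N=N1] tensor_map_pure_tensor[where M=M2 and N=N2]
        module_hom_closed[OF f(1)] module_hom_closed[OF f(3)]
        module_hom_closed[OF g(1)] module_hom_closed[OF g(3)] fcomm gcomm)
qed


section \<open>Associativity of the tensor product\<close>

context
  fixes k :: "('k, 'r) ring_scheme"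
    and M :: "('k, 'a, 'm) module_scheme" and N :: "('k, 'b, 'n) module_scheme"
    and P :: "('k, 'c, 'p) module_scheme"
  assumes M: "module k M" and N: "module k N" and P: "module k P"
begin

text \<open>
  A trilinear map \<open>\<gamma>\<close> on \<open>M \<times> N \<times> P\<close> induces a bilinear map on \<open>(M \<otimes> N) \<times> P\<close>. Linearity in \<open>P\<close> is an
  identity between linear maps on \<open>M \<otimes> N\<close>, so it may be checked on pure tensors. The mirror image
  below serves the inverse associativity map.
\<close>

lemma iterated_lift_left_bilinear:
  assumes T: "module k T"
    and \<gamma>: "\<And>z. z \<in> carrier P \<Longrightarrow> (\<lambda>x y. \<gamma> x y z) \<in> bilinear_maps k M N T"
    and \<gamma>': "\<And>x y. \<lbrakk>x \<in> carrier M; y \<in> carrier N\<rbrakk> \<Longrightarrow> (\<lambda>z. \<gamma> x y z) \<in> module_hom k P T"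
  shows "(\<lambda>u z. tensor_lift k T (\<lambda>x y. \<gamma> x y z) u) \<in> bilinear_maps k (tensor k M N) P T"
proof (rule bilinear_mapsI)
  interpret P: module k P by (fact P)
  note lin = tensor_lift_linear[OF M N T \<gamma>]
  note pure = tensor_lift_pure_tensor[OF M N T \<gamma>]
  show "tensor_lift k T (\<lambda>x y. \<gamma> x y z) \<in> module_hom k (tensor k M N) T" if "z \<in> carrier P" for z
    using that by (rule lin)
  fix u assume u: "u \<in> carrier (tensor k M N)"
  show "(\<lambda>z. tensor_lift k T (\<lambda>x y. \<gamma> x y z) u) \<in> module_hom k P T"
  proof (rule module_homI)
    fix z assume "z \<in> carrier P"
    thus "tensor_lift k T (\<lambda>x y. \<gamma> x y z) u \<in> carrier T" by (rule module_hom_closed[OF lin u])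
  next
    fix z z' assume z: "z \<in> carrier P" "z' \<in> carrier P"
    show "tensor_lift k T (\<lambda>x y. \<gamma> x y (z \<oplus>\<^bsub>P\<^esub> z')) u =
        tensor_lift k T (\<lambda>x y. \<gamma> x y z) u \<oplus>\<^bsub>T\<^esub> tensor_lift k T (\<lambda>x y. \<gamma> x y z') u"
      by (rule tensor_hom_eqI[OF M N T lin module_hom_sum[OF T lin lin] _ u])
        (use z in \<open>simp_all add: pure module_hom_add[OF \<gamma>']\<close>)
  next
    fix c z assume z: "c \<in> carrier k" "z \<in> carrier P"
    show "tensor_lift k T (\<lambda>x y. \<gamma> x y (c \<odot>\<^bsub>P\<^esub> z)) u =
        c \<odot>\<^bsub>T\<^esub> tensor_lift k T (\<lambda>x y. \<gamma> x y z) u"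
      by (rule tensor_hom_eqI[OF M N T lin module_hom_scaled[OF T lin] _ u])
        (use z in \<open>simp_all add: pure module_hom_smult[OF \<gamma>']\<close>)
  qed
qed

lemma iterated_lift_right_bilinear:
  assumes T: "module k T"
    and \<gamma>: "\<And>x. x \<in> carrier M \<Longrightarrow> (\<lambda>y z. \<gamma> x y z) \<in> bilinear_maps k N P T"
    and \<gamma>': "\<And>y z. \<lbrakk>y \<in> carrier N; z \<in> carrier P\<rbrakk> \<Longrightarrow> (\<lambda>x. \<gamma> x y z) \<in> module_hom k M T"
  shows "(\<lambda>x u. tensor_lift k T (\<lambda>y z. \<gamma> x y z) u) \<in> bilinear_maps k M (tensor k N P) T"
proof (rule bilinear_mapsI)
  interpret M: module k M by (fact M)
  note lin = tensor_lift_linear[OF N P T \<gamma>]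
  note pure = tensor_lift_pure_tensor[OF N P T \<gamma>]
  show "tensor_lift k T (\<lambda>y z. \<gamma> x y z) \<in> module_hom k (tensor k N P) T" if "x \<in> carrier M" for x
    using that by (rule lin)
  fix u assume u: "u \<in> carrier (tensor k N P)"
  show "(\<lambda>x. tensor_lift k T (\<lambda>y z. \<gamma> x y z) u) \<in> module_hom k M T"
  proof (rule module_homI)
    fix x assume "x \<in> carrier M"
    thus "tensor_lift k T (\<lambda>y z. \<gamma> x y z) u \<in> carrier T" by (rule module_hom_closed[OF lin u])
  next
    fix x x' assume x: "x \<in> carrier M" "x' \<in> carrier M"
    show "tensor_lift k T (\<lambda>y z. \<gamma> (x \<oplus>\<^bsub>M\<^esub> x') y z) u =
        tensor_lift k T (\<lambda>y z. \<gamma> x y z) u \<oplus>\<^bsub>T\<^esub> tensor_lift k T (\<lambda>y z. \<gamma> x' y z) u"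
      by (rule tensor_hom_eqI[OF N P T lin module_hom_sum[OF T lin lin] _ u])
        (use x in \<open>simp_all add: pure module_hom_add[OF \<gamma>']\<close>)
  next
    fix c x assume x: "c \<in> carrier k" "x \<in> carrier M"
    show "tensor_lift k T (\<lambda>y z. \<gamma> (c \<odot>\<^bsub>M\<^esub> x) y z) u =
        c \<odot>\<^bsub>T\<^esub> tensor_lift k T (\<lambda>y z. \<gamma> x y z) u"
      by (rule tensor_hom_eqI[OF N P T lin module_hom_scaled[OF T lin] _ u])
        (use x in \<open>simp_all add: pure module_hom_smult[OF \<gamma>']\<close>)
  qed
qed

lemma
  shows tensor_assoc_linear: "tensor_assoc k M N P
      \<in> module_hom k (tensor k (tensor k M N) P) (tensor k M (tensor k N P))"
    and tensor_assoc_pure_tensor: "\<lbrakk>x \<in> carrier M; y \<in> carrier N; z \<in> carrier P\<rbrakk> \<Longrightarrow>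
      tensor_assoc k M N P (pure_tensor k (tensor k M N) P (pure_tensor k M N x y) z) =
      pure_tensor k M (tensor k N P) x (pure_tensor k N P y z)"
proof -
  let ?T = "tensor k M (tensor k N P)"
  let ?\<gamma> = "\<lambda>x y z. pure_tensor k M (tensor k N P) x (pure_tensor k N P y z)"
  have MN: "module k (tensor k M N)" and NP: "module k (tensor k N P)"
    by (intro module_tensor M N P)+
  have T: "module k ?T" by (intro module_tensor M NP)
  note outer = pure_tensor_bilinear[OF M NP] and inner = pure_tensor_bilinear[OF N P]
  have \<gamma>: "(\<lambda>x y. ?\<gamma> x y z) \<in> bilinear_maps k M N ?T" if "z \<in> carrier P" for z
    using bilinear_maps_pullback[OF outer module_hom_id bilinear_maps_left[OF inner that]] .
  have \<gamma>': "(\<lambda>z. ?\<gamma> x y z) \<in> module_hom k P ?T" if "x \<in> carrier M" "y \<in> carrier N" for x y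
    using module_hom_compose[OF bilinear_maps_right[OF inner that(2)]
        bilinear_maps_right[OF outer that(1)]] .
  note bil = iterated_lift_left_bilinear[OF T \<gamma> \<gamma>']
  show "tensor_assoc k M N P \<in> module_hom k (tensor k (tensor k M N) P) ?T"
    unfolding tensor_assoc_def Let_def by (intro tensor_lift_linear MN P T bil)
  assume xyz: "x \<in> carrier M" "y \<in> carrier N" "z \<in> carrier P"
  have "tensor_assoc k M N P (pure_tensor k (tensor k M N) P (pure_tensor k M N x y) z) =
      tensor_lift k ?T (\<lambda>x y. ?\<gamma> x y z) (pure_tensor k M N x y)"
    unfolding tensor_assoc_def Let_def
    by (intro tensor_lift_pure_tensor MN P T bil xyz pure_tensor_closed M N)
  also have "\<dots> = ?\<gamma> x y z"
    by (intro tensor_lift_pure_tensor M N T \<gamma> xyz)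
  finally show "tensor_assoc k M N P (pure_tensor k (tensor k M N) P (pure_tensor k M N x y) z) =
    ?\<gamma> x y z" .
qed

lemma
  shows tensor_assoc_inv_linear: "tensor_assoc_inv k M N P
      \<in> module_hom k (tensor k M (tensor k N P)) (tensor k (tensor k M N) P)"
    and tensor_assoc_inv_pure_tensor: "\<lbrakk>x \<in> carrier M; y \<in> carrier N; z \<in> carrier P\<rbrakk> \<Longrightarrow>
      tensor_assoc_inv k M N P (pure_tensor k M (tensor k N P) x (pure_tensor k N P y z)) =
      pure_tensor k (tensor k M N) P (pure_tensor k M N x y) z"
proof -
  let ?T = "tensor k (tensor k M N) P"
  let ?\<gamma> = "\<lambda>x y z. pure_tensor k (tensor k M N) P (pure_tensor k M N x y) z"
  have MN: "module k (tensor k M N)" and NP: "module k (tensor k N P)"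
    by (intro module_tensor M N P)+
  have T: "module k ?T" by (intro module_tensor MN P)
  note outer = pure_tensor_bilinear[OF MN P] and inner = pure_tensor_bilinear[OF M N]
  have \<gamma>: "(\<lambda>y z. ?\<gamma> x y z) \<in> bilinear_maps k N P ?T" if "x \<in> carrier M" for x
    using bilinear_maps_pullback[OF outer bilinear_maps_right[OF inner that] module_hom_id] .
  have \<gamma>': "(\<lambda>x. ?\<gamma> x y z) \<in> module_hom k M ?T" if "y \<in> carrier N" "z \<in> carrier P" for y z
    using module_hom_compose[OF bilinear_maps_left[OF inner that(1)]
        bilinear_maps_left[OF outer that(2)]] .
  note bil = iterated_lift_right_bilinear[OF T \<gamma> \<gamma>']
  show "tensor_assoc_inv k M N P \<in> module_hom k (tensor k M (tensor k N P)) ?T"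
    unfolding tensor_assoc_inv_def Let_def by (intro tensor_lift_linear M NP T bil)
  assume xyz: "x \<in> carrier M" "y \<in> carrier N" "z \<in> carrier P"
  have "tensor_assoc_inv k M N P (pure_tensor k M (tensor k N P) x (pure_tensor k N P y z)) =
      tensor_lift k ?T (\<lambda>y z. ?\<gamma> x y z) (pure_tensor k N P y z)"
    unfolding tensor_assoc_inv_def Let_def
    by (intro tensor_lift_pure_tensor M NP T bil xyz pure_tensor_closed N P)
  also have "\<dots> = ?\<gamma> x y z"
    by (intro tensor_lift_pure_tensor N P T \<gamma> xyz)
  finally show "tensor_assoc_inv k M N P (pure_tensor k M (tensor k N P) x (pure_tensor k N P y z)) =
    ?\<gamma> x y z" .
qed

text \<open>
  For fixed \<open>z\<close>, both maps are linear in \<open>u \<in> M \<otimes> N\<close> when evaluated at \<open>u \<otimes> z\<close>, so the principle for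
  two factors applies twice.
\<close>

lemma tensor_hom_eqI_left_nested:
  assumes T: "module k T"
    and F: "F \<in> module_hom k (tensor k (tensor k M N) P) T"
    and G: "G \<in> module_hom k (tensor k (tensor k M N) P) T"
    and eq: "\<And>x y z. \<lbrakk>x \<in> carrier M; y \<in> carrier N; z \<in> carrier P\<rbrakk> \<Longrightarrow>
      F (pure_tensor k (tensor k M N) P (pure_tensor k M N x y) z) =
      G (pure_tensor k (tensor k M N) P (pure_tensor k M N x y) z)"
    and t: "t \<in> carrier (tensor k (tensor k M N) P)"
  shows "F t = G t"
proof -
  have MN: "module k (tensor k M N)" by (rule module_tensor[OF M N])
  note left = bilinear_maps_left[OF pure_tensor_bilinear[OF MN P]]
  show ?thesis
    by (rule tensor_hom_eqI[OF MN P T F G _ t],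
        rule tensor_hom_eqI[OF M N T module_hom_compose[OF left F] module_hom_compose[OF left G]])
      (auto intro: eq)
qed

lemma tensor_hom_eqI_right_nested:
  assumes T: "module k T"
    and F: "F \<in> module_hom k (tensor k M (tensor k N P)) T"
    and G: "G \<in> module_hom k (tensor k M (tensor k N P)) T"
    and eq: "\<And>x y z. \<lbrakk>x \<in> carrier M; y \<in> carrier N; z \<in> carrier P\<rbrakk> \<Longrightarrow>
      F (pure_tensor k M (tensor k N P) x (pure_tensor k N P y z)) =
      G (pure_tensor k M (tensor k N P) x (pure_tensor k N P y z))"
    and t: "t \<in> carrier (tensor k M (tensor k N P))"
  shows "F t = G t"
proof -
  have NP: "module k (tensor k N P)" by (rule module_tensor[OF N P])
  note right = bilinear_maps_right[OF pure_tensor_bilinear[OF M NP]]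
  show ?thesis
    by (rule tensor_hom_eqI[OF M NP T F G _ t],
        rule tensor_hom_eqI[OF N P T module_hom_compose[OF right F] module_hom_compose[OF right G]])
      (auto intro: eq)
qed

end

lemma
  assumes M: "module k M" and N: "module k N" and P: "module k P"
    and M': "module k M'" and N': "module k N'" and P': "module k P'"
    and f: "f \<in> module_hom k M M'" and g: "g \<in> module_hom k N N'" and h: "h \<in> module_hom k P P'"
  shows tensor_assoc_natural: "t \<in> carrier (tensor k (tensor k M N) P) \<Longrightarrow>
      tensor_assoc k M' N' P' (tensor_map k (tensor k M' N') P' (tensor_map k M' N' f g) h t) =
      tensor_map k M' (tensor k N' P') f (tensor_map k N' P' g h) (tensor_assoc k M N P t)"
    and tensor_assoc_inv_natural: "s \<in> carrier (tensor k M (tensor k N P)) \<Longrightarrow>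
      tensor_assoc_inv k M' N' P' (tensor_map k M' (tensor k N' P') f (tensor_map k N' P' g h) s) =
      tensor_map k (tensor k M' N') P' (tensor_map k M' N' f g) h (tensor_assoc_inv k M N P s)"
proof -
  note T = module_tensor[OF M N] module_tensor[OF N P]
    module_tensor[OF M' N'] module_tensor[OF N' P']
  note fg = tensor_map_linear[OF M N M' N' f g] and gh = tensor_map_linear[OF N P N' P' g h]
  note fg_h = tensor_map_linear[OF T(1) P T(3) P' fg h]
    and f_gh = tensor_map_linear[OF M T(2) M' T(4) f gh]
  note pure = tensor_map_pure_tensor[OF M N M' N' f g] tensor_map_pure_tensor[OF N P N' P' g h]
    tensor_map_pure_tensor[OF T(1) P T(3) P' fg h] tensor_map_pure_tensor[OF M T(2) M' T(4) f gh]
    tensor_assoc_pure_tensor[OF M N P] tensor_assoc_pure_tensor[OF M' N' P']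
    tensor_assoc_inv_pure_tensor[OF M N P] tensor_assoc_inv_pure_tensor[OF M' N' P']
    module_hom_closed[OF f] module_hom_closed[OF g] module_hom_closed[OF h]
    pure_tensor_closed[OF M N] pure_tensor_closed[OF N P]
  show "tensor_assoc k M' N' P' (tensor_map k (tensor k M' N') P' (tensor_map k M' N' f g) h t) =
      tensor_map k M' (tensor k N' P') f (tensor_map k N' P' g h) (tensor_assoc k M N P t)"
    if "t \<in> carrier (tensor k (tensor k M N) P)"
    by (rule tensor_hom_eqI_left_nested[OF M N P module_tensor[OF M' T(4)]
          module_hom_compose[OF fg_h tensor_assoc_linear[OF M' N' P']]
          module_hom_compose[OF tensor_assoc_linear[OF M N P] f_gh] _ that])
      (simp add: pure)
  show "tensor_assoc_inv k M' N' P' (tensor_map k M' (tensor k N' P') f (tensor_map k N' P' g h) s) =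
      tensor_map k (tensor k M' N') P' (tensor_map k M' N' f g) h (tensor_assoc_inv k M N P s)"
    if "s \<in> carrier (tensor k M (tensor k N P))"
    by (rule tensor_hom_eqI_right_nested[OF M N P module_tensor[OF T(3) P']
          module_hom_compose[OF f_gh tensor_assoc_inv_linear[OF M' N' P']]
          module_hom_compose[OF tensor_assoc_inv_linear[OF M N P] fg_h] _ that])
      (simp add: pure)
qed


section \<open>Quotient algebras\<close>

lemma assoc_algebra_module: "assoc_algebra k A \<Longrightarrow> module k A"
  by (simp add: assoc_algebra_def)

lemma mult_bilinear:
  assumes "assoc_algebra k A"
  shows "mult A \<in> bilinear_maps k A A A"
proof -
  interpret assoc_algebra k A by fact
  show ?thesis
    by (intro bilinear_mapsI module_homI)
      (auto simp: A.l_distr A.r_distr smult_mult_left smult_mult_right)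
qed

lemma mult_map_linear:
  assumes "assoc_algebra k A"
  shows "mult_map k A \<in> module_hom k (tensor k A A) A"
  unfolding mult_map_def
  by (intro tensor_lift_linear assoc_algebra_module mult_bilinear assms)

lemma mult_map_pure_tensor:
  assumes "assoc_algebra k A" "x \<in> carrier A" "y \<in> carrier A"
  shows "mult_map k A (pure_tensor k A A x y) = x \<otimes>\<^bsub>A\<^esub> y"
  unfolding mult_map_def
  by (intro tensor_lift_pure_tensor assoc_algebra_module mult_bilinear assms)

lemma mult_map_natural:
  assumes A: "assoc_algebra k A" and B: "assoc_algebra k B" and p: "p \<in> assoc_algebra_hom k A B"
    and t: "t \<in> carrier (tensor k A A)"
  shows "mult_map k B (tensor_map k B B p p t) = p (mult_map k A t)"
proof -
  note MA = assoc_algebra_module[OF A] and MB = assoc_algebra_module[OF B]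
  have lin: "p \<in> module_hom k A B" and ring: "p \<in> ring_hom A B"
    using p by (auto simp: assoc_algebra_hom_def)
  show ?thesis
    by (rule tensor_hom_eqI[OF MA MA MB
          module_hom_compose[OF tensor_map_linear[OF MA MA MB MB lin lin] mult_map_linear[OF B]]
          module_hom_compose[OF mult_map_linear[OF A] lin] _ t])
      (simp add: tensor_map_pure_tensor[OF MA MA MB MB lin lin] mult_map_pure_tensor[OF A]
        mult_map_pure_tensor[OF B] module_hom_closed[OF lin] ring_hom_mult[OF ring])
qed

lemma
  assumes "assoc_algebra k A" "submodule J k A" "ideal J A"
  shows assoc_algebra_quot_module: "assoc_algebra k (A QuotM J)"
    and quot_module_proj_algebra_hom: "(\<lambda>a. J +>\<^bsub>A\<^esub> a) \<in> assoc_algebra_hom k A (A QuotM J)"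
proof -
  interpret assoc_algebra k A by fact
  interpret J: ideal J A by fact
  let ?B = "A QuotM J"
  have M: "module k ?B"
    by (rule module_quot_module) (fact module_axioms assms(2))+
  interpret B: module k ?B by (fact M)
  have proj: "(\<lambda>a. J +>\<^bsub>A\<^esub> a) \<in> module_hom k A ?B"
    by (rule quot_module_proj_linear) (fact module_axioms assms(2))+
  note carr = quot_module_simps(1)[of A J]
  have mult: "(J +>\<^bsub>A\<^esub> x) \<otimes>\<^bsub>?B\<^esub> (J +>\<^bsub>A\<^esub> y) = J +>\<^bsub>A\<^esub> (x \<otimes>\<^bsub>A\<^esub> y)"
    if "x \<in> carrier A" "y \<in> carrier A" for x y
    using that by (simp add: quot_module_simps J.rcoset_mult_add)
  have one: "\<one>\<^bsub>?B\<^esub> = J +>\<^bsub>A\<^esub> \<one>\<^bsub>A\<^esub>" by (simp add: quot_module_simps)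
  note lin = module_hom_add[OF proj, symmetric] module_hom_smult[OF proj, symmetric]
  have ring: "ring ?B"
  proof (rule ringI)
    show "abelian_group ?B" by (rule B.M.abelian_group_axioms)
    show "Group.monoid ?B"
      by (rule monoidI) (auto simp: carr mult one A.m_assoc)
  qed (auto simp: carr mult lin A.l_distr A.r_distr)
  show "assoc_algebra k ?B"
    by (intro assoc_algebra.intro assoc_algebra_axioms.intro)
      (fact field_axioms M ring | auto simp: carr mult lin smult_mult_left smult_mult_right)+
  show "(\<lambda>a. J +>\<^bsub>A\<^esub> a) \<in> assoc_algebra_hom k A ?B"
    unfolding assoc_algebra_hom_def using proj
    by (auto intro!: ring_hom_memI simp: mult one lin) (auto simp: carr)
qed

text \<open>
  The value at a coset is that of \<open>h\<close> at a chosen representative; two representatives differ by an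
  element of \<open>N\<close>, which \<open>h\<close> kills. Extensionality fixes the values off the carrier, which
  uniqueness as a function requires.
\<close>

lemma quot_module_factorization:
  assumes "module k M" "submodule N k M" "module k P"
    and h: "h \<in> module_hom k M P" and zero: "\<And>x. x \<in> N \<Longrightarrow> h x = \<zero>\<^bsub>P\<^esub>"
  obtains h' where "h' \<in> extensional (carrier (M QuotM N))" "h' \<in> module_hom k (M QuotM N) P"
    "\<And>x. x \<in> carrier M \<Longrightarrow> h' (N +>\<^bsub>M\<^esub> x) = h x"
proof -
  interpret M: module k M by fact
  interpret P: module k P by fact
  interpret N: abelian_subgroup N M by (rule submodule_abelian_subgroup) fact+
  let ?Q = "M QuotM N"
  define h' where
    "h' = (\<lambda>C\<in>carrier ?Q. h (SOME x. x \<in> carrier M \<and> C = N +>\<^bsub>M\<^esub> x))"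
  have h': "h' (N +>\<^bsub>M\<^esub> x) = h x" if x: "x \<in> carrier M" for x
  proof -
    define y where "y = (SOME y. y \<in> carrier M \<and> N +>\<^bsub>M\<^esub> x = N +>\<^bsub>M\<^esub> y)"
    have y: "y \<in> carrier M" "N +>\<^bsub>M\<^esub> x = N +>\<^bsub>M\<^esub> y"
      unfolding y_def using someI[of "\<lambda>y. y \<in> carrier M \<and> N +>\<^bsub>M\<^esub> x = N +>\<^bsub>M\<^esub> y" x] x by blast+
    hence "x \<in> N +>\<^bsub>M\<^esub> y" using N.a_rcos_self[OF x] by simp
    then obtain n where n: "n \<in> N" "x = n \<oplus>\<^bsub>M\<^esub> y" by (auto simp: a_r_coset_def')
    hence "h x = h n \<oplus>\<^bsub>P\<^esub> h y" using y(1) by (simp add: module_hom_add[OF h])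
    hence "h x = h y" using zero[OF n(1)] y(1) by (simp add: module_hom_closed[OF h])
    thus ?thesis using x by (simp add: h'_def y_def quot_module_simps(1))
  qed
  note proj = quot_module_proj_linear[OF assms(1,2)]
  have "h' \<in> module_hom k ?Q P"
    by (rule module_homI)
      (auto simp: quot_module_simps(1) module_hom_add[OF proj, symmetric]
        module_hom_smult[OF proj, symmetric] h' module_homD[OF h])
  with h' show thesis by (intro that[of h']) (auto simp: h'_def)
qed


section \<open>Nearly Frobenius structures on quotients\<close>

text \<open>
  A nearly Frobenius structure descends along a surjective algebra homomorphism to every linear
  map \<open>\<Delta>'\<close> that is compatible with it: write the argument of each axiom as an image under \<open>p\<close> or
  \<open>p \<otimes> p\<close> and move \<open>p\<close> to the outside through every map involved.
\<close>

lemma nearly_frobenius_algebra_image: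
  assumes "nearly_frobenius_algebra k A \<Delta>" and B: "assoc_algebra k B"
    and p: "p \<in> assoc_algebra_hom k A B" and surj: "p ` carrier A = carrier B"
    and \<Delta>': "\<Delta>' \<in> module_hom k B (tensor k B B)"
    and compat: "\<And>a. a \<in> carrier A \<Longrightarrow> \<Delta>' (p a) = tensor_map k B B p p (\<Delta> a)"
  shows "nearly_frobenius_algebra k B \<Delta>'"
proof -
  interpret nearly_frobenius_algebra k A \<Delta> by fact
  have A: "assoc_algebra k A" by (rule assoc_algebra_axioms)
  note MA = assoc_algebra_module[OF A] and MB = assoc_algebra_module[OF B]
  let ?AA = "tensor k A A" and ?BB = "tensor k B B"
  let ?pp = "tensor_map k B B p p"
  note AA = module_tensor[OF MA MA] and BB = module_tensor[OF MB MB]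
  have p: "p \<in> assoc_algebra_hom k A B" and lin: "p \<in> module_hom k A B"
    using p by (auto simp: assoc_algebra_hom_def)
  note pp = tensor_map_linear[OF MA MA MB MB lin lin]
  note \<Delta> = coproduct_linear
  note I = module_hom_id
  note mA = mult_map_linear[OF A] and mB = mult_map_linear[OF B]
  note nat = tensor_assoc_natural[OF MA MA MA MB MB MB lin lin lin]
  note nat_inv = tensor_assoc_inv_natural[OF MA MA MA MB MB MB lin lin lin]
  note \<Delta>1 = tensor_map_linear[OF MA MA AA MA \<Delta> I]
  note one\<Delta> = tensor_map_linear[OF MA MA MA AA I \<Delta>]
  \<comment> \<open>These four identities carry \<open>p\<close> past \<open>\<Delta> \<otimes> 1\<close>, \<open>1 \<otimes> \<Delta>\<close>, \<open>1 \<otimes> m\<close> and \<open>m \<otimes> 1\<close>.\<close>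
  have sq_left: "tensor_map k ?BB B \<Delta>' (\<lambda>x. x) (?pp t) =
      tensor_map k ?BB B ?pp p (tensor_map k ?AA A \<Delta> (\<lambda>x. x) t)" if "t \<in> carrier ?AA" for t
    by (rule tensor_map_commuting_squares[OF MA MA MB MB AA MA BB MB lin \<Delta>' \<Delta> pp lin I I lin _ _ that])
      (simp_all add: compat)
  have sq_right: "tensor_map k B ?BB (\<lambda>x. x) \<Delta>' (?pp t) =
      tensor_map k B ?BB p ?pp (tensor_map k A ?AA (\<lambda>x. x) \<Delta> t)" if "t \<in> carrier ?AA" for t
    by (rule tensor_map_commuting_squares[OF MA MA MB MB MA AA MB BB lin I I lin lin \<Delta>' \<Delta> pp _ _ that])
      (simp_all add: compat)
  have mult_right: "tensor_map k B B (\<lambda>x. x) (mult_map k B) (tensor_map k B ?BB p ?pp t) =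
      ?pp (tensor_map k A A (\<lambda>x. x) (mult_map k A) t)" if "t \<in> carrier (tensor k A ?AA)" for t
    by (rule tensor_map_commuting_squares[OF MA AA MB BB MA MA MB MB lin I I lin pp mB mA lin _ _ that])
      (simp_all add: mult_map_natural[OF A B p])
  have mult_left: "tensor_map k B B (mult_map k B) (\<lambda>x. x) (tensor_map k ?BB B ?pp p t) =
      ?pp (tensor_map k A A (mult_map k A) (\<lambda>x. x) t)" if "t \<in> carrier (tensor k ?AA A)" for t
    by (rule tensor_map_commuting_squares[OF AA MA BB MB MA MA MB MB pp mB mA lin lin I I lin _ _ that])
      (simp_all add: mult_map_natural[OF A B p])
  show ?thesis
  proof (intro nearly_frobenius_algebra.intro nearly_frobenius_algebra_axioms.intro B \<Delta>')
    fix b assume "b \<in> carrier B"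
    then obtain a where a: "a \<in> carrier A" "b = p a" using surj by blast
    have \<Delta>a: "\<Delta> a \<in> carrier ?AA" using module_hom_closed[OF \<Delta>] a by blast
    show "tensor_assoc k B B B (tensor_map k ?BB B \<Delta>' (\<lambda>x. x) (\<Delta>' b)) =
        tensor_map k B ?BB (\<lambda>x. x) \<Delta>' (\<Delta>' b)"
      by (simp add: a compat sq_left[OF \<Delta>a] sq_right[OF \<Delta>a]
          nat[OF module_hom_closed[OF \<Delta>1 \<Delta>a]] coassoc)
  next
    fix s assume "s \<in> carrier ?BB"
    then obtain t where t: "t \<in> carrier ?AA" "s = ?pp t"
      using tensor_map_surj[OF MA MA MB MB lin lin surj surj] by blast
    have m: "mult_map k A t \<in> carrier A" by (rule module_hom_closed[OF mA t(1)])
    have l: "tensor_map k ?AA A \<Delta> (\<lambda>x. x) t \<in> carrier (tensor k ?AA A)"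
      by (rule module_hom_closed[OF \<Delta>1 t(1)])
    have r: "tensor_map k A ?AA (\<lambda>x. x) \<Delta> t \<in> carrier (tensor k A ?AA)"
      by (rule module_hom_closed[OF one\<Delta> t(1)])
    have \<Delta>'m: "\<Delta>' (mult_map k B s) = ?pp (\<Delta> (mult_map k A t))"
      by (simp add: t mult_map_natural[OF A B p t(1)] compat[OF m])
    show "\<Delta>' (mult_map k B s) = tensor_map k B B (\<lambda>x. x) (mult_map k B)
        (tensor_assoc k B B B (tensor_map k ?BB B \<Delta>' (\<lambda>x. x) s))"
      unfolding \<Delta>'m bimodule_left[OF t(1)]
      by (simp add: t(2) sq_left[OF t(1)] nat[OF l]
          mult_right[OF module_hom_closed[OF tensor_assoc_linear[OF MA MA MA] l]])
    show "\<Delta>' (mult_map k B s) = tensor_map k B B (mult_map k B) (\<lambda>x. x)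
        (tensor_assoc_inv k B B B (tensor_map k B ?BB (\<lambda>x. x) \<Delta>' s))"
      unfolding \<Delta>'m bimodule_right[OF t(1)]
      by (simp add: t(2) sq_right[OF t(1)] nat_inv[OF r]
          mult_left[OF module_hom_closed[OF tensor_assoc_inv_linear[OF MA MA MA] r]])
  qed
qed

text \<open>
  On a generator \<open>x \<otimes> y\<close> of the image of \<open>U \<otimes> V\<close> the value is \<open>f x \<otimes> g y\<close>, which has a zero factor.
\<close>

lemma tensor_map_subtensor_zero:
  assumes M: "module k M" and N: "module k N" and M': "module k M'" and N': "module k N'"
    and U: "submodule U k M" and V: "submodule V k N"
    and f: "f \<in> module_hom k M M'" and g: "g \<in> module_hom k N N'"
    and zero: "(\<forall>x\<in>U. f x = \<zero>\<^bsub>M'\<^esub>) \<or> (\<forall>y\<in>V. g y = \<zero>\<^bsub>N'\<^esub>)"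
    and t: "t \<in> subtensor k M N U V"
  shows "t \<in> carrier (tensor k M N)" "tensor_map k M' N' f g t = \<zero>\<^bsub>tensor k M' N'\<^esub>"
proof -
  let ?U = "M\<lparr>carrier := U\<rparr>" and ?V = "N\<lparr>carrier := V\<rparr>"
  let ?T' = "tensor k M' N'"
  have MU: "module k ?U" by (rule submodule.submodule_is_module[OF U M])
  have NV: "module k ?V" by (rule submodule.submodule_is_module[OF V N])
  have UM: "U \<subseteq> carrier M" "V \<subseteq> carrier N"
    using module.submoduleE(1)[OF M U] module.submoduleE(1)[OF N V] .
  have iU: "(\<lambda>x. x) \<in> module_hom k ?U M" and iV: "(\<lambda>x. x) \<in> module_hom k ?V N"
    using UM by (auto simp: module_hom_def)
  note inc = tensor_map_linear[OF MU NV M N iU iV]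
  note fg = tensor_map_linear[OF M N M' N' f g]
  note T' = module_tensor[OF M' N']
  interpret T': module k ?T' by (fact T')
  note bil = pure_tensor_bilinear[OF M' N']
  obtain s where s: "s \<in> carrier (tensor k ?U ?V)" "t = tensor_map k M N (\<lambda>x. x) (\<lambda>y. y) s"
    using t by (auto simp: subtensor_def)
  show "t \<in> carrier (tensor k M N)" using module_hom_closed[OF inc] s by simp
  have zero_left: "pure_tensor k M' N' \<zero>\<^bsub>M'\<^esub> y = \<zero>\<^bsub>?T'\<^esub>" if "y \<in> carrier N'" for y
    by (rule module_hom_zero[OF M' T' bilinear_maps_left[OF bil that]])
  have zero_right: "pure_tensor k M' N' x \<zero>\<^bsub>N'\<^esub> = \<zero>\<^bsub>?T'\<^esub>" if "x \<in> carrier M'" for x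
    by (rule module_hom_zero[OF N' T' bilinear_maps_right[OF bil that]])
  have const: "(\<lambda>_. \<zero>\<^bsub>?T'\<^esub>) \<in> module_hom k (tensor k ?U ?V) ?T'"
    by (rule module_homI) auto
  show "tensor_map k M' N' f g t = \<zero>\<^bsub>?T'\<^esub>"
    unfolding s(2)
  proof (rule tensor_hom_eqI[OF MU NV T' module_hom_compose[OF inc fg] const _ s(1)])
    fix x y assume "x \<in> carrier ?U" "y \<in> carrier ?V"
    thus "tensor_map k M' N' f g (tensor_map k M N (\<lambda>x. x) (\<lambda>y. y) (pure_tensor k ?U ?V x y)) =
        \<zero>\<^bsub>?T'\<^esub>"
      using zero UM
      by (auto simp: tensor_map_pure_tensor[OF MU NV M N iU iV]
          tensor_map_pure_tensor[OF M N M' N' f g] subset_iff zero_left zero_right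
          module_hom_closed[OF f] module_hom_closed[OF g])
  qed
qed

theorem proposition3p5:
  fixes k :: "('k, 'r) ring_scheme" and A :: "('k, 'a, 'm) module_scheme"
    and \<Delta> :: "'a \<Rightarrow> ('a \<times> 'a \<Rightarrow> 'k) set" and J :: "'a set"
  assumes "nearly_frobenius_algebra k A \<Delta>"
    and "nearly_frobenius_ideal k A \<Delta> J"
  shows "\<exists>!\<Delta>'. \<Delta>' \<in> extensional (carrier (A QuotM J)) \<and>
    nearly_frobenius_algebra k (A QuotM J) \<Delta>' \<and>
    (\<lambda>a. J +>\<^bsub>A\<^esub> a) \<in> nearly_frobenius_hom k A \<Delta> (A QuotM J) \<Delta>'"
proof -
  interpret nearly_frobenius_algebra k A \<Delta> by fact
  have A: "assoc_algebra k A" by (rule assoc_algebra_axioms)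
  note MA = assoc_algebra_module[OF A]
  have J: "submodule J k A" "ideal J A"
    and \<Delta>J: "\<Delta> ` J \<subseteq> subtensor k A A J (carrier A) <+>\<^bsub>tensor k A A\<^esub> subtensor k A A (carrier A) J"
    using assms(2) by (auto simp: nearly_frobenius_ideal_def)
  let ?B = "A QuotM J" and ?p = "\<lambda>a. J +>\<^bsub>A\<^esub> a"
  let ?pp = "tensor_map k ?B ?B ?p ?p"
  have B: "assoc_algebra k ?B" and p: "?p \<in> assoc_algebra_hom k A ?B"
    by (rule assoc_algebra_quot_module[OF A J], rule quot_module_proj_algebra_hom[OF A J])
  note MB = assoc_algebra_module[OF B]
  have lin: "?p \<in> module_hom k A ?B" by (rule quot_module_proj_linear[OF MA J(1)])
  have surj: "?p ` carrier A = carrier ?B" by (simp add: quot_module_simps)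
  note pp = tensor_map_linear[OF MA MA MB MB lin lin]
  note BB = module_tensor[OF MB MB]
  interpret BB: module k "tensor k ?B ?B" by (fact BB)
  have p_zero: "\<forall>x\<in>J. ?p x = \<zero>\<^bsub>?B\<^esub>"
    using quot_module_proj_zero[OF MA J(1)] by blast
  note carrA = module.carrier_is_submodule[OF MA]
  have vanish: "?pp (\<Delta> x) = \<zero>\<^bsub>tensor k ?B ?B\<^esub>" if "x \<in> J" for x
  proof -
    obtain u v where u: "u \<in> subtensor k A A J (carrier A)" and v: "v \<in> subtensor k A A (carrier A) J"
      and \<Delta>x: "\<Delta> x = u \<oplus>\<^bsub>tensor k A A\<^esub> v"
      using subsetD[OF \<Delta>J imageI[OF \<open>x \<in> J\<close>]] by (auto simp: set_add_def')
    note u' = tensor_map_subtensor_zero[OF MA MA MB MB J(1) carrA lin lin disjI1[OF p_zero] u]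
    note v' = tensor_map_subtensor_zero[OF MA MA MB MB carrA J(1) lin lin disjI2[OF p_zero] v]
    show ?thesis
      unfolding \<Delta>x module_hom_add[OF pp u'(1) v'(1)] u'(2) v'(2) by simp
  qed
  obtain \<Delta>' where ext: "\<Delta>' \<in> extensional (carrier ?B)"
    and lin': "\<Delta>' \<in> module_hom k ?B (tensor k ?B ?B)"
    and compat: "\<And>a. a \<in> carrier A \<Longrightarrow> \<Delta>' (?p a) = ?pp (\<Delta> a)"
    using quot_module_factorization[OF MA J(1) BB module_hom_compose[OF coproduct_linear pp] vanish]
    by metis
  have "nearly_frobenius_algebra k ?B \<Delta>'"
    by (rule nearly_frobenius_algebra_image[OF assms(1) B p surj lin' compat])
  moreover have "?p \<in> nearly_frobenius_hom k A \<Delta> ?B \<Delta>'"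
    using p compat by (simp add: nearly_frobenius_hom_def)
  moreover have "\<Delta>'' = \<Delta>'"
    if "\<Delta>'' \<in> extensional (carrier ?B)" "?p \<in> nearly_frobenius_hom k A \<Delta> ?B \<Delta>''" for \<Delta>''
  proof (rule extensionalityI[OF that(1) ext])
    fix b assume "b \<in> carrier ?B"
    then obtain a where "a \<in> carrier A" "b = ?p a" using surj by blast
    thus "\<Delta>'' b = \<Delta>' b" using that(2) compat by (simp add: nearly_frobenius_hom_def)
  qed
  ultimately show ?thesis using ext by (intro ex1I[of _ \<Delta>']) blast+
qed

end
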